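(* Let a collection of $\nu$ local topological types of locally irreducible plane curve singularities be candidates to be the singularities of a rational cuspidal plane curve of degree $d$, and assume that with $H=H_1\diamond\cdots\diamond H_\nu$ (the minimum convolution of the counting functions of their semigroups) they satisfy $$H(jd+1)=\frac{(j+1)(j+2)}{2}\qquad\text{for all }j=0,1,\dots,d-3.\tag{$*$}$$ Then any other collection of local types of locally irreducible plane curve singularities such that the multiset of all multiplicities occurring in its multiplicity sequences is the same as for the original collection, as a new candidate (with the same $d$), satisfies the condition $( * )$ as well, with $H$ replaced by the minimum convolution of the counting functions of the new collection.
   Context: The multiplicity sequence of a locally irreducible plane curve singularity is the non-increasing sequence of multiplicities of its successive strict transforms under blow-up, with the $1$'s at the end omitted (so all entries are $>1$). The semigroup $\Gamma\subset\mathbb{Z}_{\ge0}$ of the singularity is the set of its intersection multiplicities with curve germs not containing it; its delta-invariant is $\#(\mathbb{Z}_{\ge0}\setminus\Gamma)$ and its counting function is $k\mapsto\#\{s\in\Gamma:s<k\}$, $k\in\mathbb{Z}$. For functions $G_1,G_2$ on the integers bounded from below, $(G_1\diamond G_2)(j)=\min_{j_1+j_2=j}\{G_1(j_1)+G_2(j_2)\}$ (with $j_1,j_2\in\mathbb{Z}$); this operation is associative and commutative. A collection of $\nu$ local topological types of locally irreducible plane curve singularities with sum of delta-invariants $\delta$ is called a candidate to be the $\nu$ singularities of a rational cuspidal plane curve of degree $d$ if $2\delta=(d-1)(d-2)$ for the integer $d$. (By a theorem of Borodzik and Livingston, condition $( * )$ is necessary for a candidate to be realized by a rational cuspidal curve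 of degree $d$.) A multiset records elements with their numbers of appearances. *)

theory Defs
  imports
    Complex_Main
    "HOL-Library.Multiset"
    "HOL-Computational_Algebra.Computational_Algebra"
begin

text \<open>
  A series \<open>F :: complex fps fps\<close> is read as \<open>\<Sum>i j. (F $ i $ j) x^i y^j\<close>: the outer variable is \<open>x\<close>,
  the inner one is \<open>y\<close>. The bound below says that \<open>F\<close> converges absolutely in a polydisc around
  the origin.
\<close>

definition convergent_series :: "complex fps fps \<Rightarrow> bool" where
  "convergent_series F \<longleftrightarrow> (\<exists>C r::real. \<forall>i j. norm (F $ i $ j) \<le> C * r ^ (i + j))"

lemma convergent_seriesE:
  assumes "convergent_series F"
  obtains C r :: real where "C \<ge> 0" "r \<ge> 0" "\<And>i j. norm (F $ i $ j) \<le> C * r ^ (i + j)"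
proof -
  obtain C r :: real where *: "\<And>i j. norm (F $ i $ j) \<le> C * r ^ (i + j)"
    using assms unfolding convergent_series_def by blast
  have "norm (F $ i $ j) \<le> \<bar>C\<bar> * \<bar>r\<bar> ^ (i + j)" for i j
  proof -
    have "C * r ^ (i + j) \<le> \<bar>C * r ^ (i + j)\<bar>" by (rule abs_ge_self)
    then show ?thesis using *[of i j] by (simp add: abs_mult power_abs)
  qed
  then show ?thesis using that[of "\<bar>C\<bar>" "\<bar>r\<bar>"] by simp
qed

lemma convergent_series_add:
  assumes "convergent_series F" "convergent_series G"
  shows "convergent_series (F + G)"
proof -
  obtain C r :: real where F: "C \<ge> 0" "r \<ge> 0" "\<And>i j. norm (F $ i $ j) \<le> C * r ^ (i + j)"
    using convergent_seriesE[OF assms(1)] by metis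
  obtain D s :: real where G: "D \<ge> 0" "s \<ge> 0" "\<And>i j. norm (G $ i $ j) \<le> D * s ^ (i + j)"
    using convergent_seriesE[OF assms(2)] by metis
  have "norm ((F + G) $ i $ j) \<le> (C + D) * (max r s) ^ (i + j)" for i j
  proof -
    have "norm ((F + G) $ i $ j) \<le> C * r ^ (i + j) + D * s ^ (i + j)"
      using norm_triangle_ineq[of "F $ i $ j" "G $ i $ j"] F(3)[of i j] G(3)[of i j] by simp
    also have "\<dots> \<le> C * (max r s) ^ (i + j) + D * (max r s) ^ (i + j)"
      using F G by (intro add_mono mult_left_mono power_mono) auto
    finally show ?thesis by (simp add: algebra_simps)
  qed
  then show ?thesis unfolding convergent_series_def by blast
qed

lemma convergent_series_uminus: "convergent_series F \<Longrightarrow> convergent_series (- F)"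
  by (simp add: convergent_series_def)

lemma convergent_series_diff:
  "convergent_series F \<Longrightarrow> convergent_series G \<Longrightarrow> convergent_series (F - G)"
  using convergent_series_add[of F "- G"] convergent_series_uminus[of G] by simp

lemma convergent_series_const: "convergent_series (fps_const (fps_const c))"
  unfolding convergent_series_def
  by (intro exI[of _ "norm c"] exI[of _ "1::real"]) auto

lemma convergent_series_mult:
  assumes "convergent_series F" "convergent_series G"
  shows "convergent_series (F * G)"
proof -
  obtain C r :: real where F: "C \<ge> 0" "r \<ge> 0" "\<And>i j. norm (F $ i $ j) \<le> C * r ^ (i + j)"
    using convergent_seriesE[OF assms(1)] by metis
  obtain D s :: real where G: "D \<ge> 0" "s \<ge> 0" "\<And>i j. norm (G $ i $ j) \<le> D * s ^ (i + j)"
    using convergent_seriesE[OF assms(2)] by metis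
  define t where "t = max r s"
  have t: "t \<ge> 0" using F(2) unfolding t_def by auto
  have F': "norm (F $ i $ j) \<le> C * t ^ (i + j)" for i j
    by (rule order.trans[OF F(3)]) (use F in \<open>auto simp: t_def intro!: mult_left_mono power_mono\<close>)
  have G': "norm (G $ i $ j) \<le> D * t ^ (i + j)" for i j
    by (rule order.trans[OF G(3)]) (use G in \<open>auto simp: t_def intro!: mult_left_mono power_mono\<close>)
  have "norm ((F * G) $ i $ j) \<le> (C * D) * (2 * t) ^ (i + j)" for i j
  proof -
    have term_le: "norm (F $ a $ b * G $ (i - a) $ (j - b)) \<le> C * D * t ^ (i + j)"
      if "a \<le> i" "b \<le> j" for a b
    proof -
      have "norm (F $ a $ b * G $ (i - a) $ (j - b))
              \<le> (C * t ^ (a + b)) * (D * t ^ ((i - a) + (j - b)))"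
        unfolding norm_mult using F' G' F(1) t by (intro mult_mono) auto
      also have "\<dots> = C * D * t ^ ((a + b) + ((i - a) + (j - b)))"
        by (simp only: power_add mult_ac)
      also have "(a + b) + ((i - a) + (j - b)) = i + j" using that by simp
      finally show ?thesis .
    qed
    have "norm ((F * G) $ i $ j)
            = norm (\<Sum>a=0..i. \<Sum>b=0..j. F $ a $ b * G $ (i - a) $ (j - b))"
      by (simp add: fps_mult_nth fps_sum_nth)
    also have "\<dots> \<le> (\<Sum>a=0..i. \<Sum>b=0..j. C * D * t ^ (i + j))"
      using term_le by (intro sum_norm_le) auto
    also have "\<dots> = real (Suc i) * real (Suc j) * (C * D * t ^ (i + j))" by simp
    also have "\<dots> \<le> (2 ^ i * 2 ^ j) * (C * D * t ^ (i + j))"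
    proof (intro mult_right_mono mult_mono)
      have *: "real (Suc n) \<le> 2 ^ n" for n :: nat
        by (induction n) auto
      show "real (Suc i) \<le> 2 ^ i" "real (Suc j) \<le> 2 ^ j" by (rule *)+
    qed (use F(1) G(1) t in auto)
    also have "\<dots> = (C * D) * (2 * t) ^ (i + j)"
      by (simp add: power_mult_distrib power_add mult_ac)
    finally show ?thesis .
  qed
  then show ?thesis unfolding convergent_series_def by blast
qed

typedef germ = "{F :: complex fps fps. convergent_series F}"
  morphisms series Germ
  using convergent_series_const[of 0] by blast

setup_lifting type_definition_germ

instantiation germ :: idom
begin

lift_definition zero_germ :: germ is 0
  using convergent_series_const[of 0] by simp

lift_definition one_germ :: germ is 1
  using convergent_series_const[of 1] by simp

lift_definition plus_germ :: "germ \<Rightarrow> germ \<Rightarrow> germ" is "(+)"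
  by (rule convergent_series_add)

lift_definition minus_germ :: "germ \<Rightarrow> germ \<Rightarrow> germ" is "(-)"
  by (rule convergent_series_diff)

lift_definition uminus_germ :: "germ \<Rightarrow> germ" is uminus
  by (rule convergent_series_uminus)

lift_definition times_germ :: "germ \<Rightarrow> germ \<Rightarrow> germ" is "(*)"
  by (rule convergent_series_mult)

instance
  by standard (transfer; simp add: algebra_simps)+

end

lift_definition const_germ :: "complex \<Rightarrow> germ" is "\<lambda>c. fps_const (fps_const c)"
  by (rule convergent_series_const)

text \<open>The multiplicity at the origin of the curve \<open>f = 0\<close> (for \<open>f \<noteq> 0\<close>): the order of \<open>f\<close>.\<close>

definition curve_mult :: "germ \<Rightarrow> nat" where
  "curve_mult f = (LEAST n. \<exists>i j. i + j = n \<and> series f $ i $ j \<noteq> 0)"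

text \<open>
  A locally irreducible plane curve germ is given by an irreducible element of the ring of
  convergent power series; it is singular iff its multiplicity exceeds \<open>1\<close>.
\<close>

definition irreducible_singularity :: "germ \<Rightarrow> bool" where
  "irreducible_singularity f \<longleftrightarrow> irreducible f \<and> curve_mult f > 1"

text \<open>
  The total transform \<open>F(u, u (v + c))\<close>, as a series in \<open>u\<close> (outer) and \<open>v\<close> (inner): the monomial
  \<open>x^i y^j\<close> becomes \<open>u^(i+j) (v + c)^j\<close>. This is the blow-up of the origin in coordinates centred at
  the point of the exceptional line \<open>u = 0\<close> that corresponds to the tangent direction \<open>y = c x\<close>.
\<close>

definition total_transform :: "complex \<Rightarrow> complex fps fps \<Rightarrow> complex fps fps" where
  "total_transform c F =
     Abs_fps (\<lambda>n. \<Sum>j\<le>n. fps_const (F $ (n - j) $ j) * (fps_X + fps_const c) ^ j)"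

definition swap_series :: "complex fps fps \<Rightarrow> complex fps fps" where
  "swap_series F = Abs_fps (\<lambda>i. Abs_fps (\<lambda>j. F $ j $ i))"

text \<open>
  \<open>f'\<close> is a strict transform of \<open>f\<close> at a point of the exceptional line lying on it. The second
  disjunct is the chart \<open>(x, y) = (u v, u)\<close>, which is needed for the direction \<open>x = 0\<close>. An irreducible
  \<open>f\<close> has a single tangent, so exactly one point of the exceptional line qualifies.
\<close>

definition strict_transform :: "germ \<Rightarrow> germ \<Rightarrow> bool" where
  "strict_transform f f' \<longleftrightarrow>
     ((\<exists>c. total_transform c (series f) = fps_X ^ curve_mult f * series f') \<or>
      total_transform 0 (swap_series (series f)) = fps_X ^ curve_mult f * series f') \<and>
     series f' $ 0 $ 0 = 0"

inductive multiplicity_sequence :: "germ \<Rightarrow> nat list \<Rightarrow> bool" where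
  smooth: "curve_mult f = 1 \<Longrightarrow> multiplicity_sequence f []"
| blow_up: "curve_mult f > 1 \<Longrightarrow> strict_transform f f' \<Longrightarrow> multiplicity_sequence f' ms \<Longrightarrow>
            multiplicity_sequence f (curve_mult f # ms)"

text \<open>\<open>B\<close> represents a (finite) complex basis of the quotient of the ring by the ideal \<open>I\<close>.\<close>

definition quotient_basis :: "germ set \<Rightarrow> germ set \<Rightarrow> bool" where
  "quotient_basis I B \<longleftrightarrow> finite B \<and>
     (\<forall>h. \<exists>c. h - (\<Sum>b\<in>B. const_germ (c b) * b) \<in> I) \<and>
     (\<forall>c. (\<Sum>b\<in>B. const_germ (c b) * b) \<in> I \<longrightarrow> (\<forall>b\<in>B. c b = 0))"

text \<open>
  The intersection multiplicity at the origin of \<open>f = 0\<close> and \<open>g = 0\<close>: the complex dimension of the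
  quotient by the ideal \<open>(f, g)\<close>, which is finite if \<open>f\<close> is irreducible and does not divide \<open>g\<close>.
\<close>

definition intersection_mult :: "germ \<Rightarrow> germ \<Rightarrow> nat" where
  "intersection_mult f g =
     (THE n. \<exists>B. quotient_basis {f * a + g * b | a b. True} B \<and> card B = n)"

text \<open>A unit \<open>g\<close> (a curve not passing through the origin) contributes \<open>0\<close>.\<close>

definition curve_semigroup :: "germ \<Rightarrow> nat set" where
  "curve_semigroup f = {intersection_mult f g | g. \<not> f dvd g}"

text \<open>The complement is finite for irreducible \<open>f\<close>.\<close>

definition delta_invariant :: "germ \<Rightarrow> nat" where
  "delta_invariant f = card (- curve_semigroup f)"

definition counting_function :: "germ \<Rightarrow> int \<Rightarrow> int" where
  "counting_function f k = int (card {s \<in> curve_semigroup f. int s < k})"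

text \<open>
  For functions that are bounded from below the set is nonempty and bounded from below, so that
  its infimum in the integers is a minimum.
\<close>

definition min_conv :: "(int \<Rightarrow> int) \<Rightarrow> (int \<Rightarrow> int) \<Rightarrow> int \<Rightarrow> int"  (infixr \<open>\<diamondop>\<close> 70) where
  "(G1 \<diamondop> G2) j = Inf {G1 j1 + G2 j2 | j1 j2. j1 + j2 = j}"

text \<open>
  The value for the empty list is a dummy: without singularities the sum of delta-invariants
  is \<open>0\<close>, so that \<open>d \<le> 2\<close> and \<open>degree_condition\<close> below is vacuous.
\<close>

fun min_conv_list :: "(int \<Rightarrow> int) list \<Rightarrow> int \<Rightarrow> int" where
  "min_conv_list [] = (\<lambda>_. 0)"
| "min_conv_list [G] = G"
| "min_conv_list (G # G' # Gs) = G \<diamondop> min_conv_list (G' # Gs)"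

text \<open>
  A collection of local topological types is given by a list of singularities representing them;
  semigroup and multiplicity sequence depend only on the topological type.
\<close>

definition candidate :: "int \<Rightarrow> germ list \<Rightarrow> bool" where
  "candidate d fs \<longleftrightarrow> (\<forall>f\<in>set fs. irreducible_singularity f) \<and>
     2 * (\<Sum>f\<leftarrow>fs. int (delta_invariant f)) = (d - 1) * (d - 2)"

definition degree_condition :: "int \<Rightarrow> germ list \<Rightarrow> bool" where
  "degree_condition d fs \<longleftrightarrow>
     (\<forall>j\<in>{0..d - 3}. min_conv_list (map counting_function fs) (j * d + 1) = (j + 1) * (j + 2) div 2)"

end

theory Submission
  imports Defs "HOL-Library.Extended_Nat" "HOL-Library.Set_Algebras" "HOL-Library.Product_Plus"
begin

text \<open>
  Write \<open>H_f\<close> for the counting function of the semigroup of \<open>f\<close>, which is also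
  \<open>k \<mapsto> dim O / {h. v h \<ge> k}\<close> for the valuation \<open>v\<close> on the ring \<open>O\<close> of germs given by the
  intersection multiplicity with \<open>f\<close>. Let \<open>f'\<close> be the strict transform of an irreducible \<open>f\<close> of
  multiplicity \<open>n\<close>. Everything rests on the recursion
  \<open>H_f(k) = min {a (a + 1) / 2 + H_f'(k - n a) | a \<ge> 0}\<close>.

  To see it, compare \<open>{h. v h \<ge> k}\<close> with the ideal \<open>m^a\<close> of germs of order at least \<open>a\<close>, whose
  codimension is \<open>a (a + 1) / 2\<close>. An element of \<open>m^a\<close> pulls back to \<open>u^a h'\<close>, so that
  \<open>v h = n a + v' h'\<close>; hence at most \<open>H_f'(k - n a)\<close> values below \<open>k\<close> are taken on \<open>m^a\<close>, which
  gives \<open>\<le>\<close> for every \<open>a\<close> (\<open>card_semigroup_le\<close>). For the converse let \<open>a\<close> be the least order of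
  an element \<open>h\<close> with \<open>v h \<ge> k\<close>. The factor \<open>h'\<close> of its pull-back is regular in the second
  coordinate of order at most \<open>a\<close>, and the remainder of Weierstrass division by \<open>h'\<close> has degree
  below \<open>a\<close> in that coordinate, so that its product with \<open>u^a\<close> is the pull-back of an element of
  \<open>m^a\<close>. As \<open>v' h' \<ge> k - n a\<close>, a germ upstairs of value \<open>s < k - n a\<close> has a remainder of the
  same value \<open>s\<close>, and so \<open>n a + s\<close> is a value of \<open>v\<close> on \<open>m^a\<close> (\<open>card_semigroup_ge\<close>).

  Since \<open>H_f(k) = max 0 k\<close> for smooth \<open>f\<close>, the recursion gives
  \<open>H_f(k) = min {p + max 0 (k - q)}\<close>, where \<open>(p, q)\<close> runs over the Minkowski sum of the sets
  \<open>{(a (a + 1) / 2, n a) | a \<ge> 0}\<close>, one for each entry \<open>n\<close> of the multiplicity sequence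
  (\<open>counting_function_multiplicities\<close>). Minimum convolution of functions of this shape adds the
  sets of pairs (\<open>cost_envelope_append\<close>), so that \<open>H_1 \<diamondop> \<dots> \<diamondop> H_\<nu>\<close> depends only on the
  multiset of all multiplicities. The same holds for the sum of the delta-invariants, which the
  growth of the counting functions determines as the sum of the \<open>n (n - 1) / 2\<close>.

  The valuation is built along the resolution: it is the order of the remainder modulo \<open>f\<close> for a
  smooth \<open>f\<close>, and \<open>v = v' \<circ> \<pi>\<close> for the pull-back \<open>\<pi>\<close> of germs under the blow-up. That \<open>f\<close>
  is irreducible enters through \<open>blow_down\<close>: a factor \<open>h\<close> of \<open>f'\<close> of order \<open>e\<close> in the second
  coordinate comes from a germ of order \<open>e\<close> that divides \<open>f\<close>. Hence \<open>f'\<close> is irreducible and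
  meets the exceptional line with multiplicity exactly \<open>n\<close>, and \<open>f'\<close> divides \<open>\<pi> g\<close> only if \<open>f\<close>
  divides \<open>g\<close>.
\<close>

section \<open>Weierstrass division for convergent series\<close>

text \<open>
  Finite sections of the weighted \<open>l^1\<close> norm on series in \<open>y\<close>. They are submultiplicative for a
  fixed \<open>J\<close>, so that norms of products can be estimated without any convergence argument.
\<close>

definition partial_norm :: "real \<Rightarrow> nat \<Rightarrow> complex fps \<Rightarrow> real" where
  "partial_norm s J a = (\<Sum>j\<le>J. norm (a $ j) * s ^ j)"

lemma partial_norm_nonneg: "s \<ge> 0 \<Longrightarrow> partial_norm s J a \<ge> 0"
  by (simp add: partial_norm_def sum_nonneg)

lemma partial_norm_diff:
  "s \<ge> 0 \<Longrightarrow> partial_norm s J (a - b) \<le> partial_norm s J a + partial_norm s J b"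
  unfolding partial_norm_def sum.distrib [symmetric]
  by (intro sum_mono) (simp add: distrib_right [symmetric] mult_right_mono norm_triangle_ineq4)

lemma partial_norm_sum:
  "s \<ge> 0 \<Longrightarrow> partial_norm s J (\<Sum>l\<in>A. a l) \<le> (\<Sum>l\<in>A. partial_norm s J (a l))"
  unfolding partial_norm_def
  by (subst sum.swap, intro sum_mono) (simp add: fps_sum_nth sum_distrib_right [symmetric] mult_right_mono norm_sum)

lemma partial_norm_mult:
  assumes "s \<ge> 0"
  shows "partial_norm s J (a * b) \<le> partial_norm s J a * partial_norm s J b"
proof -
  define g where "g = (\<lambda>i k. (norm (a $ i) * s ^ i) * (norm (b $ k) * s ^ k))"
  have "partial_norm s J (a * b) \<le> (\<Sum>j\<le>J. \<Sum>i\<le>j. g i (j - i))"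
    unfolding partial_norm_def
  proof (intro sum_mono)
    fix j
    have "norm ((a * b) $ j) * s ^ j \<le> (\<Sum>i\<le>j. norm (a $ i) * norm (b $ (j - i))) * s ^ j"
      unfolding fps_mult_nth atMost_atLeast0 using assms
      by (intro mult_right_mono sum_norm_le) (auto simp: norm_mult)
    also have "\<dots> = (\<Sum>i\<le>j. g i (j - i))"
      unfolding g_def sum_distrib_right
      by (intro sum.cong) (auto simp: power_add [symmetric] mult_ac)
    finally show "norm ((a * b) $ j) * s ^ j \<le> (\<Sum>i\<le>j. g i (j - i))" .
  qed
  also have "\<dots> = (\<Sum>(i, k)\<in>{(i, k). i + k \<le> J}. g i k)"
    by (rule sum.triangle_reindex_eq [symmetric])
  also have "\<dots> \<le> (\<Sum>(i, k)\<in>{..J} \<times> {..J}. g i k)"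
    using assms by (intro sum_mono2) (auto simp: g_def)
  also have "\<dots> = partial_norm s J a * partial_norm s J b"
    by (simp add: partial_norm_def g_def sum_product sum.cartesian_product)
  finally show ?thesis .
qed

lemma partial_norm_shift:
  assumes "s > 0"
  shows "partial_norm s J (fps_shift e a) \<le> partial_norm s (J + e) a / s ^ e"
proof -
  have "partial_norm s J (fps_shift e a) * s ^ e = (\<Sum>j\<le>J. norm (a $ (j + e)) * s ^ (j + e))"
    by (simp add: partial_norm_def sum_distrib_right power_add mult.assoc)
  also have "\<dots> = (\<Sum>j\<in>(\<lambda>j. j + e) ` {..J}. norm (a $ j) * s ^ j)"
    by (subst sum.reindex) (auto simp: inj_on_def)
  also have "\<dots> \<le> partial_norm s (J + e) a"
    unfolding partial_norm_def using assms by (intro sum_mono2) auto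
  finally show ?thesis using assms by (simp add: field_simps)
qed

lemma norm_nth_le_partial_norm:
  assumes "s > 0"
  shows "norm (a $ j) \<le> partial_norm s j a * (1 / s) ^ j"
proof -
  have "norm (a $ j) * s ^ j \<le> partial_norm s j a"
    unfolding partial_norm_def using assms
    by (intro member_le_sum [of j _ "\<lambda>j. norm (a $ j) * s ^ j"]) auto
  then show ?thesis using assms by (simp add: field_simps)
qed

lemma partial_norm_geometric:
  assumes "\<And>j. norm (a $ j) \<le> C * R ^ j" and "C \<ge> 0" "R > 0"
  shows "partial_norm (1 / (2 * R)) J a \<le> 2 * C"
proof -
  have "partial_norm (1 / (2 * R)) J a \<le> (\<Sum>j\<le>J. C * (1 / 2) ^ j)"
    unfolding partial_norm_def
  proof (intro sum_mono)
    fix j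
    have "norm (a $ j) * (1 / (2 * R)) ^ j \<le> (C * R ^ j) * (1 / (2 * R)) ^ j"
      using assms by (intro mult_right_mono) auto
    also have "\<dots> = C * (1 / 2) ^ j" using assms(3)
      by (simp add: power_mult_distrib power_divide)
    finally show "norm (a $ j) * (1 / (2 * R)) ^ j \<le> C * (1 / 2) ^ j" .
  qed
  also have "\<dots> = C * (\<Sum>j\<le>J. (1 / 2) ^ j)" by (simp add: sum_distrib_left)
  also have "(\<Sum>j\<le>J. (1 / 2 :: real) ^ j) = 2 - (1 / 2) ^ J"
    by (induction J) auto
  also have "C * (2 - (1 / 2) ^ J) \<le> C * 2" using assms(2) by (intro mult_left_mono) auto
  finally show ?thesis by simp
qed

text \<open>
  The solution of \<open>x_i = K (R^i + \<Sum>l<i. x_l R^(i-l))\<close> grows only geometrically. Both the inverse of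
  a series and the rows of the Weierstrass quotient obey such a recurrence, and so they converge.
\<close>

lemma geometric_recurrence:
  fixes K R :: real
  shows "K * (R ^ i + (\<Sum>l<i. K * (R * (1 + K)) ^ l * R ^ (i - l))) = K * (R * (1 + K)) ^ i"
proof -
  have "(\<Sum>l<i. K * (R * (1 + K)) ^ l * R ^ (i - l)) = R ^ i * (K * (\<Sum>l<i. (1 + K) ^ l))"
    unfolding sum_distrib_left
    by (intro sum.cong)
      (auto simp: power_mult_distrib mult_ac simp flip: power_add)
  also have "K * (\<Sum>l<i. (1 + K) ^ l) = (1 + K) ^ i - 1"
    by (induction i) (auto simp: algebra_simps)
  finally show ?thesis by (simp add: right_diff_distrib power_mult_distrib)
qed

text \<open>
  After division by the constant term, the equation \<open>w * inverse w = 1\<close> expresses each coefficient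
  of the inverse by the earlier ones.
\<close>

lemma fps_inverse_geometric:
  fixes w :: "complex fps"
  assumes w: "\<And>j. norm (w $ j) \<le> C * R ^ j" and "C \<ge> 0" "R \<ge> 0" and w0: "w $ 0 \<noteq> 0"
  shows "\<exists>K S. K \<ge> 0 \<and> S \<ge> 0 \<and> (\<forall>j. norm (inverse w $ j) \<le> K * S ^ j)"
proof -
  define K where "K = (C + 1) / norm (w $ 0)"
  have K: "K \<ge> 0" using assms(2) by (simp add: K_def)
  have "norm (inverse w $ j) \<le> K * (R * (1 + K)) ^ j" for j
  proof (induction j rule: less_induct)
    case (less j)
    have bound: "norm (inverse w $ j)
        \<le> K * (R ^ j + (\<Sum>l<j. norm (inverse w $ l) * R ^ (j - l)))"
    proof (cases j)
      case 0
      then show ?thesis using assms(2) by (simp add: K_def norm_inverse norm_divide inverse_eq_divide divide_right_mono)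
    next
      case (Suc m)
      have "(inverse w * w) $ j = 0"
        using w0 Suc by (simp add: inverse_mult_eq_1)
      then have "inverse w $ j * w $ 0 = - (\<Sum>l<j. inverse w $ l * w $ (j - l))"
        unfolding fps_mult_nth atMost_atLeast0 [symmetric] lessThan_Suc_atMost [symmetric]
        by (simp add: eq_neg_iff_add_eq_0 add.commute)
      then have "norm (inverse w $ j) * norm (w $ 0)
          = norm (\<Sum>l<j. inverse w $ l * w $ (j - l))"
        by (metis norm_minus_cancel norm_mult)
      also have "\<dots> \<le> (\<Sum>l<j. norm (inverse w $ l) * (C * R ^ (j - l)))"
        using w by (intro sum_norm_le) (auto simp: norm_mult intro!: mult_left_mono)
      also have "\<dots> = C * (\<Sum>l<j. norm (inverse w $ l) * R ^ (j - l))"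
        by (simp add: sum_distrib_left mult_ac)
      also have "\<dots> \<le> (C + 1) * (R ^ j + (\<Sum>l<j. norm (inverse w $ l) * R ^ (j - l)))"
        using assms(2,3) by (intro mult_mono) (auto intro!: sum_nonneg)
      finally show ?thesis using w0 by (simp add: K_def field_simps)
    qed
    also have "\<dots> \<le> K * (R ^ j + (\<Sum>l<j. K * (R * (1 + K)) ^ l * R ^ (j - l)))"
      using less K assms(3) by (intro mult_left_mono add_left_mono sum_mono mult_right_mono) auto
    also have "\<dots> = K * (R * (1 + K)) ^ j" by (rule geometric_recurrence)
    finally show ?case .
  qed
  then show ?thesis using K assms(3) by (intro exI [of _ K] exI [of _ "R * (1 + K)"]) auto
qed

text \<open>
  Comparing the coefficients of \<open>x^i\<close> in \<open>g = q f + r\<close> determines the row \<open>q_i\<close> from the earlier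
  ones: \<open>q_i f_0\<close> must agree with \<open>g_i - \<Sum>l<i. q_l f_(i-l)\<close> in all degrees from \<open>e\<close> on, and
  \<open>f_0\<close> is \<open>y^e\<close> times a unit.
\<close>

fun division_row :: "nat \<Rightarrow> complex fps fps \<Rightarrow> complex fps fps \<Rightarrow> nat \<Rightarrow> complex fps" where
  "division_row e F G i = inverse (fps_shift e (F $ 0)) *
     fps_shift e (G $ i - (\<Sum>l<i. division_row e F G l * F $ (i - l)))"

declare division_row.simps [simp del]

lemma convergent_division_row:
  assumes F: "convergent_series F" and G: "convergent_series G" and e: "F $ 0 $ e \<noteq> 0"
  shows "convergent_series (Abs_fps (division_row e F G))"
proof -
  obtain C r where C: "C \<ge> 0" "r \<ge> 0" "\<And>i j. norm (F $ i $ j) \<le> C * r ^ (i + j)"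
    using convergent_seriesE [OF F] by metis
  obtain D t where D: "D \<ge> 0" "t \<ge> 0" "\<And>i j. norm (G $ i $ j) \<le> D * t ^ (i + j)"
    using convergent_seriesE [OF G] by metis
  define w where "w = fps_shift e (F $ 0)"
  have "norm (w $ j) \<le> (C * r ^ e) * r ^ j" for j
    using C(3) [of 0 "j + e"] by (simp add: w_def power_add mult_ac)
  then obtain K S where K: "K \<ge> 0" "S \<ge> 0" "\<And>j. norm (inverse w $ j) \<le> K * S ^ j"
    using fps_inverse_geometric [of w "C * r ^ e" r] C(1,2) e by (auto simp: w_def)
  \<comment> \<open>With \<open>s = 1 / (2 R)\<close> all rows of \<open>F\<close> and \<open>G\<close>, and the inverse of the unit \<open>w\<close>, have a
    finite norm of radius \<open>s\<close> that grows at most like \<open>R^i\<close>.\<close>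
  define R where "R = Max {r, t, S, 1}"
  have R: "r \<le> R" "t \<le> R" "S \<le> R" "1 \<le> R" by (auto simp: R_def)
  define s where "s = 1 / (2 * R)"
  have s: "s > 0" using R by (simp add: s_def)
  have rowF: "partial_norm s J (F $ i) \<le> 2 * (C * R ^ i)" for i J
    unfolding s_def
  proof (rule partial_norm_geometric)
    show "norm (F $ i $ j) \<le> C * R ^ i * R ^ j" for j
      using C R by (intro order.trans [OF C(3)])
        (simp add: mult.assoc power_mono mult_left_mono flip: power_add)
  qed (use C R in auto)
  have rowG: "partial_norm s J (G $ i) \<le> 2 * (D * R ^ i)" for i J
    unfolding s_def
  proof (rule partial_norm_geometric)
    show "norm (G $ i $ j) \<le> D * R ^ i * R ^ j" for j
      using D R by (intro order.trans [OF D(3)])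
        (simp add: mult.assoc power_mono mult_left_mono flip: power_add)
  qed (use D R in auto)
  have rowK: "partial_norm s J (inverse w) \<le> 2 * K" for J
    unfolding s_def
  proof (rule partial_norm_geometric)
    show "norm (inverse w $ j) \<le> K * R ^ j" for j
      using K R by (intro order.trans [OF K(3)]) (simp add: power_mono mult_left_mono)
  qed (use K R in auto)
  define L where "L = 2 * K / s ^ e * (2 * D + 2 * C)"
  have L: "L \<ge> 0" using K C D s by (simp add: L_def)
  let ?q = "division_row e F G"
  have row: "partial_norm s J (?q i) \<le> L * (R * (1 + L)) ^ i" for i J
  proof (induction i arbitrary: J rule: less_induct)
    case (less i)
    define b where "b = (\<lambda>l. L * (R * (1 + L)) ^ l)"
    have b: "b l \<ge> 0" for l using L R by (simp add: b_def)
    define A where "A = G $ i - (\<Sum>l<i. ?q l * F $ (i - l))"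
    have A: "partial_norm s J A \<le> (2 * D + 2 * C) * (R ^ i + (\<Sum>l<i. b l * R ^ (i - l)))" for J
    proof -
      have "partial_norm s J A
          \<le> partial_norm s J (G $ i) + (\<Sum>l<i. partial_norm s J (?q l * F $ (i - l)))"
        unfolding A_def using s
        by (intro order.trans [OF partial_norm_diff] add_left_mono partial_norm_sum) auto
      also have "\<dots> \<le> 2 * (D * R ^ i) + (\<Sum>l<i. b l * (2 * (C * R ^ (i - l))))"
      proof (intro add_mono rowG sum_mono)
        fix l assume "l \<in> {..<i}"
        then show "partial_norm s J (?q l * F $ (i - l)) \<le> b l * (2 * (C * R ^ (i - l)))"
          using s b less [of l J] rowF [of J "i - l"]
          by (intro order.trans [OF partial_norm_mult] mult_mono)
             (auto simp: b_def partial_norm_nonneg)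
      qed
      also have "\<dots> = 2 * D * R ^ i + 2 * C * (\<Sum>l<i. b l * R ^ (i - l))"
        by (simp add: sum_distrib_left mult_ac)
      also have "\<dots> \<le> (2 * D + 2 * C) * (R ^ i + (\<Sum>l<i. b l * R ^ (i - l)))"
        using C(1) D(1) R b by (simp add: distrib_left distrib_right sum_nonneg)
      finally show ?thesis .
    qed
    have "partial_norm s J (?q i) = partial_norm s J (inverse w * fps_shift e A)"
      by (subst division_row.simps) (simp add: A_def w_def)
    also have "\<dots> \<le> (2 * K) * (partial_norm s (J + e) A / s ^ e)"
      using s K by (intro order.trans [OF partial_norm_mult] mult_mono rowK partial_norm_shift)
        (auto simp: partial_norm_nonneg)
    also have "\<dots> = (2 * K / s ^ e) * partial_norm s (J + e) A" by simp
    also have "\<dots> \<le> (2 * K / s ^ e) * ((2 * D + 2 * C) * (R ^ i + (\<Sum>l<i. b l * R ^ (i - l))))"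
      using s K by (intro mult_left_mono A) auto
    also have "\<dots> = L * (R ^ i + (\<Sum>l<i. b l * R ^ (i - l)))" by (simp add: L_def)
    also have "\<dots> = L * (R * (1 + L)) ^ i" unfolding b_def by (rule geometric_recurrence)
    finally show ?case .
  qed
  define M where "M = max (R * (1 + L)) (1 / s)"
  have M: "R * (1 + L) \<le> M" "1 / s \<le> M" "0 \<le> M"
    using s by (auto simp: M_def le_max_iff_disj)
  have "norm (?q i $ j) \<le> L * M ^ (i + j)" for i j
  proof -
    have "norm (?q i $ j) \<le> (L * (R * (1 + L)) ^ i) * (1 / s) ^ j"
      using s row [of j i]
      by (intro order.trans [OF norm_nth_le_partial_norm] mult_right_mono) auto
    also have "\<dots> \<le> (L * M ^ i) * M ^ j"
      using s L R M by (intro mult_mono mult_left_mono power_mono) auto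
    finally show ?thesis by (simp add: power_add mult_ac)
  qed
  then show ?thesis unfolding convergent_series_def by auto
qed

lemma germ_eqI: "(\<And>i j. series f $ i $ j = series g $ i $ j) \<Longrightarrow> f = g"
  by (metis fps_ext series_inject)

text \<open>
  Regularity of order \<open>e\<close> in \<open>y\<close>: the germ meets the line \<open>x = 0\<close> at the origin with multiplicity \<open>e\<close>.
\<close>

definition regular_order :: "nat \<Rightarrow> germ \<Rightarrow> bool" where
  "regular_order e f \<longleftrightarrow> series f $ 0 $ e \<noteq> 0 \<and> (\<forall>j<e. series f $ 0 $ j = 0)"

definition y_degree_below :: "nat \<Rightarrow> germ \<Rightarrow> bool" where
  "y_degree_below e r \<longleftrightarrow> (\<forall>i. \<forall>j\<ge>e. series r $ i $ j = 0)"

lemma regular_row_0: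
  assumes "regular_order e f"
  shows "series f $ 0 = fps_X ^ e * fps_shift e (series f $ 0)"
  using assms by (intro fps_ext) (auto simp: regular_order_def fps_X_power_mult_nth)

text \<open>
  The rows of the quotient are forced, and the estimates above make the quotient converge. For
  \<open>e = 0\<close> this is the invertibility of germs that do not vanish at the origin.
\<close>

theorem weierstrass_division:
  assumes f: "regular_order e f"
  obtains q r where "g = q * f + r" and "y_degree_below e r"
proof -
  define Q where "Q = Abs_fps (division_row e (series f) (series g))"
  have "convergent_series Q"
    unfolding Q_def using f series [of f] series [of g]
    by (intro convergent_division_row) (auto simp: regular_order_def)
  then have Q: "series (Germ Q) = Q" by (simp add: Germ_inverse)
  define r where "r = g - Germ Q * f"
  have "series r $ i $ j = 0" if "j \<ge> e" for i j
  proof -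
    define w where "w = fps_shift e (series f $ 0)"
    have w: "w $ 0 \<noteq> 0" using f by (simp add: w_def regular_order_def)
    define A where "A = series g $ i - (\<Sum>l<i. Q $ l * series f $ (i - l))"
    have "Q $ i * series f $ 0 = (inverse w * fps_shift e A) * (fps_X ^ e * w)"
      unfolding Q_def fps_nth_Abs_fps
      by (subst division_row.simps, subst (2) regular_row_0 [OF f])
         (simp add: A_def Q_def w_def)
    also have "\<dots> = (inverse w * w) * (fps_X ^ e * fps_shift e A)" by (simp add: mult_ac)
    finally have Qi: "Q $ i * series f $ 0 = fps_X ^ e * fps_shift e A"
      using w by (simp add: inverse_mult_eq_1)
    have "series r $ i = series g $ i - (\<Sum>l\<le>i. Q $ l * series f $ (i - l))"
      by (simp add: r_def minus_germ.rep_eq times_germ.rep_eq Q fps_mult_nth atMost_atLeast0)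
    also have "\<dots> = A - Q $ i * series f $ 0"
      by (simp add: A_def lessThan_Suc_atMost [symmetric])
    finally show ?thesis using that by (simp add: Qi fps_X_power_mult_nth)
  qed
  then have "y_degree_below e r" by (simp add: y_degree_below_def)
  then show thesis using that [of "Germ Q" r] by (simp add: r_def)
qed

text \<open>
  Once the earlier rows of the quotient are known to vanish, the next row of the multiple is that of
  the quotient times \<open>y^e\<close> and a unit. Having degree below \<open>e\<close>, it is zero.
\<close>

lemma weierstrass_unique:
  assumes f: "regular_order e f" and "f dvd r" and r: "y_degree_below e r"
  shows "r = 0"
proof -
  obtain q where q: "r = q * f" using assms(2) by (metis dvdE mult.commute)
  have "series q $ i = 0" for i
  proof (induction i rule: less_induct)
    case (less i)
    define w where "w = fps_shift e (series f $ 0)"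
    have w: "w $ 0 \<noteq> 0" using f by (simp add: w_def regular_order_def)
    have "series r $ i = (\<Sum>l\<le>i. series q $ l * series f $ (i - l))"
      by (simp add: q times_germ.rep_eq fps_mult_nth atMost_atLeast0)
    also have "\<dots> = series q $ i * series f $ 0"
      using less by (simp add: lessThan_Suc_atMost [symmetric])
    also have "\<dots> = fps_X ^ e * (w * series q $ i)"
      by (subst regular_row_0 [OF f]) (simp add: w_def mult_ac)
    finally have *: "series r $ i = fps_X ^ e * (w * series q $ i)" .
    have "(w * series q $ i) $ j = 0" for j
    proof -
      have "series r $ i $ (j + e) = 0" using r by (simp add: y_degree_below_def)
      then show ?thesis by (simp add: * fps_X_power_mult_nth)
    qed
    then have "w * series q $ i = 0" by (simp add: fps_eq_iff)
    then show ?case using w by auto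
  qed
  then have "q = 0" by (intro germ_eqI) (simp add: zero_germ.rep_eq)
  then show ?thesis by (simp add: q)
qed

lemma germ_unit_iff: "g dvd 1 \<longleftrightarrow> series g $ 0 $ 0 \<noteq> 0"
proof
  assume "g dvd 1"
  then obtain h where "1 = g * h" by (rule dvdE)
  then have "(1 :: complex fps fps) = series g * series h"
    by (metis one_germ.rep_eq times_germ.rep_eq)
  then have "1 = series g $ 0 $ 0 * series h $ 0 $ 0"
    by (metis fps_mult_nth_0 fps_one_nth)
  then show "series g $ 0 $ 0 \<noteq> 0" by auto
next
  assume "series g $ 0 $ 0 \<noteq> 0"
  then have "regular_order 0 g" by (simp add: regular_order_def)
  then obtain q r where "1 = q * g + r" "y_degree_below 0 r" by (rule weierstrass_division)
  moreover have "r = 0" using calculation(2)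
    by (intro germ_eqI) (simp add: y_degree_below_def zero_germ.rep_eq)
  ultimately show "g dvd 1" by (metis add.right_neutral dvd_triv_right)
qed

section \<open>Coordinates on the ring of germs\<close>

lemma convergent_series_X: "convergent_series fps_X"
  unfolding convergent_series_def
  by (intro exI [of _ "1::real"] exI [of _ "1::real"]) (auto simp: fps_X_def)

lemma convergent_series_Y: "convergent_series (fps_const fps_X)"
  unfolding convergent_series_def
  by (intro exI [of _ "1::real"] exI [of _ "1::real"]) (auto simp: fps_X_def)

lift_definition X :: germ is fps_X by (rule convergent_series_X)

lift_definition Y :: germ is "fps_const fps_X" by (rule convergent_series_Y)

lift_definition swap :: "germ \<Rightarrow> germ" is swap_series
proof -
  fix F assume "convergent_series F"
  then obtain C r where "\<And>i j. norm (F $ i $ j) \<le> C * r ^ (i + j)"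
    unfolding convergent_series_def by blast
  then have "norm (swap_series F $ i $ j) \<le> C * r ^ (i + j)" for i j
    by (simp add: swap_series_def add.commute [of i j])
  then show "convergent_series (swap_series F)" unfolding convergent_series_def by blast
qed

lift_definition column :: "nat \<Rightarrow> germ \<Rightarrow> germ" is "\<lambda>j F. Abs_fps (\<lambda>i. fps_const (F $ i $ j))"
proof -
  fix j F assume "convergent_series F"
  then obtain C r where C: "C \<ge> 0" "r \<ge> 0" "\<And>i j. norm (F $ i $ j) \<le> C * r ^ (i + j)"
    by (rule convergent_seriesE) blast
  have "norm (Abs_fps (\<lambda>i. fps_const (F $ i $ j)) $ i $ k) \<le> (C * r ^ j) * r ^ (i + k)" for i k
    using C(1,2) C(3) [of i j] by (simp add: power_add mult_ac)
  then show "convergent_series (Abs_fps (\<lambda>i. fps_const (F $ i $ j)))"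
    unfolding convergent_series_def by blast
qed

lemma series_power: "series (g ^ n) = series g ^ n"
  by (induction n) (simp_all add: one_germ.rep_eq times_germ.rep_eq)

lemma series_sum: "series (\<Sum>a\<in>A. g a) = (\<Sum>a\<in>A. series (g a))"
  by (induction A rule: infinite_finite_induct) (simp_all add: zero_germ.rep_eq plus_germ.rep_eq)

lemmas series_simps = zero_germ.rep_eq one_germ.rep_eq plus_germ.rep_eq minus_germ.rep_eq
  uminus_germ.rep_eq times_germ.rep_eq const_germ.rep_eq X.rep_eq Y.rep_eq swap.rep_eq
  column.rep_eq series_power series_sum

lemma const_germ_0 [simp]: "const_germ 0 = 0"
  and const_germ_1 [simp]: "const_germ 1 = 1"
  and const_germ_add: "const_germ (a + b) = const_germ a + const_germ b"
  and const_germ_diff: "const_germ (a - b) = const_germ a - const_germ b"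
  and const_germ_minus: "const_germ (- a) = - const_germ a"
  and const_germ_mult: "const_germ (a * b) = const_germ a * const_germ b"
  by (transfer; simp)+

lemma const_germ_inverse: "a \<noteq> 0 \<Longrightarrow> const_germ a * const_germ (inverse a) = 1"
  by (simp flip: const_germ_mult)

lemma nth_const_mult: "series (const_germ c * g) $ i $ j = c * series g $ i $ j"
  by (simp add: series_simps)

lemma nth_X_power_mult:
  "series (X ^ n * g) $ i = (if i < n then 0 else series g $ (i - n))"
  by (simp add: series_simps fps_X_power_mult_nth)

lemma nth_mult_Y_power:
  "series (g * Y ^ n) $ i $ j = (if j < n then 0 else series g $ i $ (j - n))"
  by (simp add: series_simps fps_const_power fps_X_power_mult_right_nth)

lemma nth_0_mult: "series (f * g) $ 0 = series f $ 0 * series g $ 0"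
  by (simp add: series_simps)

lemma X_nonzero: "X \<noteq> 0"
  by (metis X.rep_eq fps_X_neq_zero zero_germ.rep_eq)

lemma X_power_dvd_iff: "X ^ n dvd g \<longleftrightarrow> (\<forall>i<n. series g $ i = 0)"
proof
  assume "X ^ n dvd g"
  then show "\<forall>i<n. series g $ i = 0" by (auto simp: dvd_def nth_X_power_mult)
next
  assume g: "\<forall>i<n. series g $ i = 0"
  obtain C r where C: "C \<ge> 0" "r \<ge> 0" "\<And>i j. norm (series g $ i $ j) \<le> C * r ^ (i + j)"
    using convergent_seriesE series by (metis mem_Collect_eq)
  have "norm (fps_shift n (series g) $ i $ j) \<le> (C * r ^ n) * r ^ (i + j)" for i j
    using C(3) [of "i + n" j] by (simp add: power_add mult_ac)
  then have "series (Germ (fps_shift n (series g))) = fps_shift n (series g)"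
    by (intro Germ_inverse) (auto simp: convergent_series_def)
  then have "g = X ^ n * Germ (fps_shift n (series g))"
    using g by (intro germ_eqI) (simp add: nth_X_power_mult)
  then show "X ^ n dvd g" by (metis dvd_triv_left)
qed

lemma y_degree_decomposition:
  assumes "y_degree_below e g"
  shows "g = (\<Sum>j<e. column j g * Y ^ j)"
proof (rule germ_eqI)
  fix i k
  have "series (\<Sum>j<e. column j g * Y ^ j) $ i $ k
      = (\<Sum>j<e. series (column j g * Y ^ j) $ i $ k)"
    by (simp add: series_sum fps_sum_nth)
  also have "\<dots> = (\<Sum>j<e. if k = j then series g $ i $ j else 0)"
    by (intro sum.cong) (auto simp: nth_mult_Y_power column.rep_eq)
  also have "\<dots> = series g $ i $ k"
    using assms by (auto simp: y_degree_below_def)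
  finally show "series g $ i $ k = series (\<Sum>j<e. column j g * Y ^ j) $ i $ k" by simp
qed

section \<open>Order at the origin\<close>

definition order_ge :: "nat \<Rightarrow> germ \<Rightarrow> bool" where
  "order_ge n g \<longleftrightarrow> (\<forall>i j. i + j < n \<longrightarrow> series g $ i $ j = 0)"

lemma order_ge_iff_curve_mult:
  assumes "f \<noteq> 0"
  shows "order_ge n f \<longleftrightarrow> n \<le> curve_mult f"
proof -
  let ?P = "\<lambda>n. \<exists>i j. i + j = n \<and> series f $ i $ j \<noteq> 0"
  obtain i j where "series f $ i $ j \<noteq> 0"
    using assms germ_eqI [of f 0] by (auto simp: zero_germ.rep_eq)
  then have *: "?P (curve_mult f)"
    unfolding curve_mult_def by (intro LeastI [of ?P "i + j"]) auto
  have "curve_mult f \<le> m" if "?P m" for m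
    unfolding curve_mult_def using that by (rule Least_le)
  then show ?thesis using * unfolding order_ge_def
    by (metis (no_types, opaque_lifting) linorder_not_less order_less_le_trans)
qed

lemma curve_mult_leading:
  assumes "f \<noteq> 0"
  obtains i j where "i + j = curve_mult f" "series f $ i $ j \<noteq> 0"
  using order_ge_iff_curve_mult [OF assms, of "Suc (curve_mult f)"]
    order_ge_iff_curve_mult [OF assms, of "curve_mult f"]
  unfolding order_ge_def by (metis less_antisym not_less_eq_eq order_refl)

section \<open>Blowing up\<close>

text \<open>
  The coefficients of \<open>y + c\<close> have absolute sum \<open>1 + norm c\<close>, which is a submultiplicative bound.
\<close>

lemma norm_nth_linear_power: "norm (((fps_X + fps_const c) ^ j) $ m) \<le> (1 + norm c) ^ j"
  for c :: complex
proof -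
  have 1: "partial_norm 1 J (fps_X + fps_const c) \<le> 1 + norm c" for J
  proof -
    have "partial_norm 1 J (fps_X + fps_const c)
        \<le> (\<Sum>j\<le>J. (if j = 1 then 1 else 0) + (if j = 0 then norm c else 0))"
      unfolding partial_norm_def by (intro sum_mono) (auto simp: fps_X_def)
    also have "\<dots> \<le> 1 + norm c" unfolding sum.distrib
      by (intro add_mono) auto
    finally show ?thesis .
  qed
  have "partial_norm 1 J ((fps_X + fps_const c) ^ j) \<le> (1 + norm c) ^ j" for J
  proof (induction j)
    case 0
    have "partial_norm 1 J 1 = (\<Sum>j\<le>J. if j = 0 then 1 else 0)"
      unfolding partial_norm_def by (intro sum.cong) auto
    then show ?case by simp
  next
    case (Suc j)
    then show ?case unfolding power_Suc
      by (intro order.trans [OF partial_norm_mult] mult_mono 1) (auto simp: partial_norm_nonneg)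
  qed
  then show ?thesis
    using norm_nth_le_partial_norm [of 1 "(fps_X + fps_const c) ^ j" m]
    by (simp add: order.trans)
qed

lemma convergent_total_transform:
  assumes "convergent_series F"
  shows "convergent_series (total_transform c F)"
proof -
  obtain C r where C: "C \<ge> 0" "r \<ge> 0" "\<And>i j. norm (F $ i $ j) \<le> C * r ^ (i + j)"
    using convergent_seriesE [OF assms] by metis
  define R where "R = max 1 (2 * (r * (1 + norm c)))"
  have R: "1 \<le> R" "2 * (r * (1 + norm c)) \<le> R" by (auto simp: R_def)
  have "norm (total_transform c F $ n $ m) \<le> C * R ^ (n + m)" for n m
  proof -
    have "norm (total_transform c F $ n $ m) \<le> (\<Sum>j\<le>n. C * r ^ n * (1 + norm c) ^ n)"
      unfolding total_transform_def fps_nth_Abs_fps fps_sum_nth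
    proof (intro sum_norm_le)
      fix j assume "j \<in> {..n}"
      then have "norm (F $ (n - j) $ j) \<le> C * r ^ n" using C(3) [of "n - j" j] by simp
      moreover have "norm (((fps_X + fps_const c) ^ j) $ m) \<le> (1 + norm c) ^ n"
        using \<open>j \<in> {..n}\<close>
        by (intro order.trans [OF norm_nth_linear_power] power_increasing) auto
      ultimately show "norm ((fps_const (F $ (n - j) $ j) * (fps_X + fps_const c) ^ j) $ m)
          \<le> C * r ^ n * (1 + norm c) ^ n"
        using C by (auto simp: norm_mult intro!: mult_mono)
    qed
    also have "\<dots> = real (Suc n) * (C * (r * (1 + norm c)) ^ n)"
      by (simp add: power_mult_distrib mult_ac)
    also have "\<dots> \<le> 2 ^ n * (C * (r * (1 + norm c)) ^ n)"
    proof (intro mult_right_mono)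
      show "real (Suc n) \<le> 2 ^ n" by (induction n) auto
    qed (use C in auto)
    also have "\<dots> = C * (2 * (r * (1 + norm c))) ^ n" by (simp add: power_mult_distrib)
    also have "\<dots> \<le> C * R ^ n" using C R by (intro mult_left_mono power_mono) auto
    also have "\<dots> \<le> C * R ^ (n + m)" using C R by (intro mult_left_mono power_increasing) auto
    finally show ?thesis .
  qed
  then show ?thesis unfolding convergent_series_def by blast
qed

lift_definition blowup :: "complex \<Rightarrow> germ \<Rightarrow> germ" is total_transform
  by (rule convergent_total_transform)

lemma fps_const_sum: "fps_const (\<Sum>a\<in>A. f a) = (\<Sum>a\<in>A. fps_const (f a))"
  by (induction A rule: infinite_finite_induct) (simp_all flip: fps_const_add)

lemma total_transform_mult:
  "total_transform c (F * G) = total_transform c F * total_transform c G"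
proof (rule fps_ext)
  fix n
  let ?k = "fps_const :: complex \<Rightarrow> complex fps" and ?L = "fps_X + fps_const c :: complex fps"
  have "total_transform c (F * G) $ n = (\<Sum>m\<le>n. \<Sum>p\<le>n - m. \<Sum>j\<le>m.
      ?k (F $ p $ j) * ?k (G $ (n - m - p) $ (m - j)) * ?L ^ m)"
    unfolding total_transform_def fps_nth_Abs_fps fps_mult_nth fps_sum_nth atMost_atLeast0
      fps_const_sum sum_distrib_right fps_const_mult [symmetric] ..
  also have "\<dots> = (\<Sum>(m, p, j)\<in>(SIGMA m:{..n}. SIGMA p:{..n - m}. {..m}).
      ?k (F $ p $ j) * ?k (G $ (n - m - p) $ (m - j)) * ?L ^ m)"
    by (simp add: sum.Sigma)
  also have "\<dots> = (\<Sum>(a, j, l)\<in>(SIGMA a:{..n}. SIGMA j:{..a}. {..n - a}).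
      ?k (F $ (a - j) $ j) * ?k (G $ (n - a - l) $ l) * ?L ^ (j + l))"
    by (rule sum.reindex_bij_witness [of _ "\<lambda>(a, j, l). (j + l, a - j, j)"
          "\<lambda>(m, p, j). (p + j, j, m - j)"])
       (auto simp: diff_diff_eq algebra_simps)
  also have "\<dots> = (\<Sum>a\<le>n. \<Sum>j\<le>a. \<Sum>l\<le>n - a.
      (?k (F $ (a - j) $ j) * ?L ^ j) * (?k (G $ (n - a - l) $ l) * ?L ^ l))"
    by (simp add: sum.Sigma power_add mult_ac)
  also have "\<dots> = (total_transform c F * total_transform c G) $ n"
    by (simp add: total_transform_def fps_mult_nth sum_product atMost_atLeast0)
  finally show "total_transform c (F * G) $ n = (total_transform c F * total_transform c G) $ n" .
qed

lemma blowup_mult: "blowup c (f * g) = blowup c f * blowup c g"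
  by transfer (rule total_transform_mult)

lemma blowup_add: "blowup c (f + g) = blowup c f + blowup c g"
  by transfer
     (auto simp: total_transform_def fps_eq_iff sum.distrib distrib_right
           simp flip: fps_const_add)

lemma total_transform_single_column:
  assumes "\<And>i j. j \<noteq> k \<Longrightarrow> F $ i $ j = 0"
  shows "total_transform c F $ n =
    (if k \<le> n then fps_const (F $ (n - k) $ k) * (fps_X + fps_const c) ^ k else 0)"
proof -
  have "total_transform c F $ n = (\<Sum>j\<le>n. if j = k
      then fps_const (F $ (n - k) $ k) * (fps_X + fps_const c) ^ k else 0)"
    unfolding total_transform_def fps_nth_Abs_fps using assms by (intro sum.cong) auto
  then show ?thesis by simp
qed

lemma blowup_column: "blowup c (column j g) = column j g"
proof -
  have "total_transform c (series (column j g)) $ n = series (column j g) $ n" for n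
    by (subst total_transform_single_column [of 0]) (auto simp: column.rep_eq)
  then show ?thesis by (intro germ_eqI) (simp add: blowup.rep_eq)
qed

lemma blowup_const: "blowup c (const_germ a) = const_germ a"
proof -
  have "total_transform c (series (const_germ a)) $ n = series (const_germ a) $ n" for n
    by (subst total_transform_single_column [of 0]) (auto simp: const_germ.rep_eq)
  then show ?thesis by (intro germ_eqI) (simp add: blowup.rep_eq)
qed

lemma blowup_X: "blowup c X = X"
proof -
  have "total_transform c fps_X $ n = fps_X $ n" for n
    by (subst total_transform_single_column [of 0]) (auto simp: fps_X_def)
  then show ?thesis by (intro germ_eqI) (simp add: blowup.rep_eq X.rep_eq)
qed

lemma blowup_Y: "blowup c Y = X * (Y + const_germ c)"
proof -
  have "total_transform c (fps_const fps_X) $ n = series (X * (Y + const_germ c)) $ n" for n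
    by (subst total_transform_single_column [of 1])
       (auto simp: series_simps fps_X_def fps_mult_fps_X_commute)
  then show ?thesis by (intro germ_eqI) (simp add: blowup.rep_eq Y.rep_eq)
qed

lemma blowup_0 [simp]: "blowup c 0 = 0"
  and blowup_1 [simp]: "blowup c 1 = 1"
  using blowup_const [of c 0] blowup_const [of c 1] by simp_all

lemma blowup_minus: "blowup c (- f) = - blowup c f"
proof -
  have "blowup c (const_germ (- 1) * f) = const_germ (- 1) * blowup c f"
    by (simp only: blowup_mult blowup_const)
  then show ?thesis by (simp add: const_germ_minus)
qed

lemma blowup_diff: "blowup c (f - g) = blowup c f - blowup c g"
  using blowup_add [of c f "- g"] by (simp add: blowup_minus)

lemma blowup_power: "blowup c (f ^ n) = blowup c f ^ n"
  by (induction n) (simp_all add: blowup_mult)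

lemma blowup_sum: "blowup c (\<Sum>a\<in>A. g a) = (\<Sum>a\<in>A. blowup c (g a))"
  by (induction A rule: infinite_finite_induct) (simp_all add: blowup_add)

text \<open>
  The coefficient of \<open>u^n\<close> is the form of degree \<open>n\<close> of \<open>g\<close>, evaluated at \<open>(1, v + c)\<close>. It is a
  polynomial in \<open>v\<close>, and the substitution \<open>v + c\<close> neither kills it nor changes its degree.
\<close>

lemma blowup_row:
  "series (blowup c g) $ n =
     fps_of_poly (pcompose (\<Sum>j\<le>n. monom (series g $ (n - j) $ j) j) [:c, 1:])"
proof -
  have *: "fps_of_poly (pcompose (monom a j) [:c, 1:]) = fps_const a * (fps_X + fps_const c) ^ j"
    for a :: complex and j
  proof -
    have "pcompose (monom a j) [:c, 1:] = smult a ([:c, 1:] ^ j)"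
      by (induction j) (simp_all add: monom_0 monom_Suc pcompose_pCons)
    then show ?thesis
      by (simp add: fps_of_poly_smult fps_of_poly_power fps_of_poly_pCons add.commute)
  qed
  show ?thesis
    unfolding blowup.rep_eq total_transform_def fps_nth_Abs_fps pcompose_sum fps_of_poly_sum * ..
qed

lemma blowup_row_degree: "j > n \<Longrightarrow> series (blowup c g) $ n $ j = 0"
proof -
  assume "j > n"
  let ?P = "\<Sum>j\<le>n. monom (series g $ (n - j) $ j) j"
  have "degree ?P \<le> n"
    by (intro degree_sum_le) (auto intro: order.trans [OF degree_monom_le])
  then have "degree (pcompose ?P [:c, 1:]) \<le> n"
    by (simp add: degree_pcompose)
  then show ?thesis using \<open>j > n\<close> by (simp add: blowup_row coeff_eq_0)
qed

lemma blowup_row_eq_0_iff: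
  "series (blowup c g) $ n = 0 \<longleftrightarrow> (\<forall>i j. i + j = n \<longrightarrow> series g $ i $ j = 0)"
proof -
  let ?P = "\<Sum>j\<le>n. monom (series g $ (n - j) $ j) j"
  have coeff: "coeff ?P j = (if j \<le> n then series g $ (n - j) $ j else 0)" for j
    by (simp add: coeff_sum)
  have "series (blowup c g) $ n = 0 \<longleftrightarrow> pcompose ?P [:c, 1:] = 0"
    using fps_of_poly_eq_iff [of "pcompose ?P [:c, 1:]" 0] unfolding blowup_row by simp
  also have "\<dots> \<longleftrightarrow> ?P = 0"
    using pcompose_eq_0 [of ?P "[:c, 1:]"] by auto
  also have "\<dots> \<longleftrightarrow> (\<forall>j\<le>n. series g $ (n - j) $ j = 0)"
    unfolding poly_eq_iff coeff by auto
  also have "\<dots> \<longleftrightarrow> (\<forall>i j. i + j = n \<longrightarrow> series g $ i $ j = 0)"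
    by (metis add_diff_cancel_right' le_add2 le_add_diff_inverse2)
  finally show ?thesis .
qed

lemma X_power_dvd_blowup_iff: "X ^ n dvd blowup c g \<longleftrightarrow> order_ge n g"
  unfolding X_power_dvd_iff blowup_row_eq_0_iff order_ge_def by blast

lemma blowup_eq_0_iff: "blowup c g = 0 \<longleftrightarrow> g = 0"
proof
  assume "blowup c g = 0"
  then have "series (blowup c g) $ n = 0" for n by (simp add: zero_germ.rep_eq)
  then show "g = 0" unfolding blowup_row_eq_0_iff
    by (intro germ_eqI) (simp add: zero_germ.rep_eq)
qed simp

text \<open>
  The image of the pull-back contains \<open>u^(a-j) (u v)^j = u^a v^j\<close> for \<open>j \<le> a\<close>, since \<open>u v\<close> comes
  from \<open>y - c x\<close>.
\<close>

lemma blowup_surj_low_degree: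
  assumes "y_degree_below (Suc a) g"
  obtains p where "blowup c p = X ^ a * g"
proof
  have Y: "blowup c (Y - const_germ c * X) = X * Y"
    by (simp add: blowup_mult blowup_diff blowup_X blowup_Y blowup_const distrib_left mult.commute)
  have "blowup c (\<Sum>j<Suc a. column j g * (X ^ (a - j) * (Y - const_germ c * X) ^ j))
      = (\<Sum>j<Suc a. column j g * (X ^ (a - j) * (X * Y) ^ j))"
    by (simp only: blowup_sum blowup_mult blowup_column blowup_power blowup_X Y)
  also have "\<dots> = (\<Sum>j<Suc a. X ^ a * (column j g * Y ^ j))"
    by (intro sum.cong) (auto simp: power_mult_distrib mult_ac simp flip: power_add)
  also have "\<dots> = X ^ a * g"
    by (simp only: sum_distrib_left [symmetric] y_degree_decomposition [OF assms, symmetric])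
  finally show "blowup c (\<Sum>j<Suc a. column j g * (X ^ (a - j) * (Y - const_germ c * X) ^ j))
      = X ^ a * g" .
qed

lemma blowup_row_leading: "series (blowup c g) $ n $ n = series g $ 0 $ n"
proof -
  let ?P = "\<Sum>j\<le>n. monom (series g $ (n - j) $ j) j"
  have coeff: "coeff ?P n = series g $ 0 $ n" by (simp add: coeff_sum)
  have "degree ?P \<le> n"
    by (intro degree_sum_le) (auto intro: order.trans [OF degree_monom_le])
  then consider "degree ?P < n" | "degree ?P = n" by linarith
  then have "coeff (pcompose ?P [:c, 1:]) n = coeff ?P n"
  proof cases
    case 1
    then show ?thesis by (simp add: coeff_eq_0 degree_pcompose del: coeff_sum)
  next
    case 2
    then show ?thesis
      using lead_coeff_comp [of "[:c, 1:]" ?P] by (simp add: degree_pcompose del: coeff_sum)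
  qed
  then show ?thesis by (simp add: blowup_row coeff)
qed

lemma blowup_y_degree_below:
  assumes "y_degree_below e r"
  shows "y_degree_below e (blowup c r)"
  unfolding y_degree_below_def
proof (intro allI impI)
  fix n k :: nat assume "k \<ge> e"
  let ?P = "\<Sum>j\<le>n. monom (series r $ (n - j) $ j) j"
  have "coeff ?P j = 0" if "j \<ge> e" for j
    using assms that by (simp add: coeff_sum y_degree_below_def)
  then have "degree ?P < e \<or> ?P = 0"
    using degree_lessI [of ?P e] by blast
  then have "degree (pcompose ?P [:c, 1:]) < k \<or> pcompose ?P [:c, 1:] = 0"
    using \<open>k \<ge> e\<close> by (auto simp: degree_pcompose)
  then show "series (blowup c r) $ n $ k = 0"
    unfolding blowup_row by (auto simp: coeff_eq_0)
qed

section \<open>Strict transforms of irreducible germs\<close>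

lemma regular_order_iff_subdegree:
  "regular_order e f \<longleftrightarrow> series f $ 0 \<noteq> 0 \<and> subdegree (series f $ 0) = e"
  unfolding regular_order_def
  by (metis fps_nonzero_nth nth_less_subdegree_zero nth_subdegree_nonzero subdegreeI)

lemma regular_order_factors:
  assumes "regular_order n (f * g)"
  obtains a b where "regular_order a f" "regular_order b g" "n = a + b"
  using assms unfolding regular_order_iff_subdegree nth_0_mult by (auto simp: subdegree_mult)

lemma germ_unit_iff_regular: "g dvd 1 \<longleftrightarrow> regular_order 0 g"
  by (simp add: germ_unit_iff regular_order_def)

text \<open>
  Up to a unit, \<open>f\<close> is a polynomial of degree \<open>e\<close> in \<open>y\<close>: divide \<open>y^e\<close> by \<open>f\<close>. On \<open>x = 0\<close> the
  remainder vanishes for reasons of order, so that the quotient is a unit.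
\<close>

lemma weierstrass_preparation:
  assumes f: "regular_order e f"
  obtains h where "h dvd f" "f dvd h" "regular_order e h" "y_degree_below (Suc e) h"
proof -
  obtain q r where qr: "Y ^ e = q * f + r" "y_degree_below e r"
    using weierstrass_division [OF f] by metis
  have f0: "series (q * f) $ 0 = fps_X ^ e * (series q $ 0 * fps_shift e (series f $ 0))"
    unfolding nth_0_mult by (subst regular_row_0 [OF f]) (simp only: mult_ac)
  have Y: "series (Y ^ e) $ i $ j = (if i = 0 \<and> j = e then 1 else 0)" for i j
    by (simp add: series_simps fps_const_power)
  have "series (q * f) $ 0 $ j + series r $ 0 $ j = (if j = e then 1 else 0)" for j
    using Y [of 0 j] by (simp add: qr(1) plus_germ.rep_eq)
  from this [of e] have "series q $ 0 $ 0 * series f $ 0 $ e = 1"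
    using qr(2) by (simp add: y_degree_below_def f0 fps_X_power_mult_nth)
  then have "q dvd 1" by (auto simp: germ_unit_iff)
  then have 1: "q * f dvd f" by (metis dvd_refl mult_1 mult_dvd_mono)
  have 2: "q * f = Y ^ e - r" using qr(1) by simp
  have "y_degree_below (Suc e) (q * f)"
    using qr(2) unfolding 2 by (auto simp: y_degree_below_def minus_germ.rep_eq Y)
  moreover have "regular_order e (q * f)"
    using f \<open>q dvd 1\<close> unfolding germ_unit_iff_regular regular_order_iff_subdegree nth_0_mult
    by (auto simp: subdegree_mult)
  ultimately show thesis using that [of "q * f"] 1 by auto
qed

lemma order_ge_mult: "order_ge n f \<Longrightarrow> order_ge n (f * g)"
  using X_power_dvd_blowup_iff [of n 0] by (metis blowup_mult dvd_mult2)

lemma curve_mult_le_of_dvd: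
  assumes "f dvd g" "g \<noteq> 0"
  shows "curve_mult f \<le> curve_mult g"
proof -
  have "f \<noteq> 0" using assms by auto
  then show ?thesis
    using assms order_ge_mult order_ge_iff_curve_mult by (metis dvdE order_refl)
qed

text \<open>
  Let \<open>k\<close> be the Weierstrass polynomial associated with \<open>h\<close>. Then \<open>u^e k\<close> is the pull-back of a
  germ \<open>p\<close> of order \<open>e\<close>, namely \<open>x^e k(x, y/x - c)\<close>. If \<open>h\<close> divides the pull-back of \<open>g\<close>, it
  divides that of the remainder of \<open>g\<close> modulo \<open>p\<close>; the latter has degree below \<open>e\<close> in \<open>v\<close> and hence
  vanishes by uniqueness of Weierstrass division.
\<close>

lemma blow_down:
  assumes h: "regular_order e h"
  obtains p where "p \<noteq> 0" "curve_mult p = e" "\<And>g. h dvd blowup c g \<Longrightarrow> p dvd g"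
proof -
  obtain k where k: "k dvd h" "regular_order e k" "y_degree_below (Suc e) k"
    using weierstrass_preparation [OF h] by metis
  obtain p where p: "blowup c p = X ^ e * k"
    using blowup_surj_low_degree [OF k(3)] by metis
  have k0: "series k $ 0 $ e \<noteq> 0" using k(2) by (simp add: regular_order_def)
  have pe: "series (blowup c p) $ e $ j = series k $ 0 $ j" for j
    by (simp add: p nth_X_power_mult)
  then have p0: "series p $ 0 $ e \<noteq> 0" using pe [of e] k0 by (simp add: blowup_row_leading)
  then have "p \<noteq> 0" by (auto simp: zero_germ.rep_eq)
  have ord: "order_ge e p" using X_power_dvd_blowup_iff [of e c p] by (simp add: p)
  have "\<not> order_ge (Suc e) p" using p0 unfolding order_ge_def by (metis add_0 lessI)
  then have "curve_mult p = e"
    using ord \<open>p \<noteq> 0\<close> by (auto simp: order_ge_iff_curve_mult)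
  have reg: "regular_order e p" using p0 ord by (auto simp: regular_order_def order_ge_def)
  have "p dvd g" if g: "h dvd blowup c g" for g
  proof -
    obtain q r where qr: "g = q * p + r" "y_degree_below e r"
      using weierstrass_division [OF reg] by metis
    have "blowup c r = blowup c g - blowup c q * (X ^ e * k)"
      by (simp add: qr(1) blowup_add blowup_mult p)
    then have "k dvd blowup c r"
      using g k(1) by (metis dvd_diff dvd_mult dvd_trans dvd_refl)
    then have "blowup c r = 0"
      using weierstrass_unique [OF k(2)] blowup_y_degree_below [OF qr(2)] by blast
    then show ?thesis using qr(1) by (simp add: blowup_eq_0_iff)
  qed
  then show thesis using that \<open>p \<noteq> 0\<close> \<open>curve_mult p = e\<close> by blast
qed

lemma strict_transform_regular:
  assumes "f \<noteq> 0" and f': "blowup c f = X ^ curve_mult f * f'"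
  obtains e where "regular_order e f'" "e \<le> curve_mult f"
proof -
  obtain i j where "i + j = curve_mult f" "series f $ i $ j \<noteq> 0"
    using curve_mult_leading [OF assms(1)] by blast
  then have "series (blowup c f) $ curve_mult f \<noteq> 0"
    using blowup_row_eq_0_iff by blast
  then have 0: "series f' $ 0 \<noteq> 0" by (simp add: f' nth_X_power_mult)
  have deg: "series f' $ 0 $ j = 0" if "j > curve_mult f" for j
    using blowup_row_degree [OF that, of c f] by (simp add: f' nth_X_power_mult)
  have "subdegree (series f' $ 0) \<le> curve_mult f"
    using deg 0 by (meson linorder_not_le nth_subdegree_nonzero)
  then show thesis using that 0 by (simp add: regular_order_iff_subdegree)
qed

text \<open>
  Blowing \<open>h\<close> down gives a nonunit that divides the irreducible germ \<open>f\<close> and so equals it up to a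
  unit. Its order is on the one hand the order of \<open>h\<close> in \<open>v\<close>, on the other hand the multiplicity of
  \<open>f\<close>. In geometric terms, \<open>f\<close> has a single tangent and a single point above the origin.
\<close>

lemma irreducible_strict_transform_factor:
  assumes f: "irreducible f" and f': "blowup c f = X ^ curve_mult f * f'"
    and h: "h dvd f'" "\<not> h dvd 1"
  shows "regular_order (curve_mult f) h" and "h dvd blowup c g \<longleftrightarrow> f dvd g"
proof -
  have "f \<noteq> 0" using f by (simp add: irreducible_def)
  obtain e where e: "regular_order e h" "e \<le> curve_mult f"
  proof -
    obtain m where "regular_order m f'" "m \<le> curve_mult f"
      using strict_transform_regular [OF \<open>f \<noteq> 0\<close> f'] .
    moreover obtain k where "f' = h * k" using h(1) by (rule dvdE)
    ultimately show thesis using that by (metis regular_order_factors add_leD1)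
  qed
  have "e > 0" using e(1) h(2) by (metis germ_unit_iff_regular gr0I)
  obtain p where p: "p \<noteq> 0" "curve_mult p = e" "\<And>g. h dvd blowup c g \<Longrightarrow> p dvd g"
    using blow_down [OF e(1)] by metis
  have hf: "h dvd blowup c f" using h(1) by (simp add: f')
  then have pf: "p dvd f" by (rule p(3))
  have "\<not> p dvd 1"
    using p(1,2) \<open>e > 0\<close> order_ge_iff_curve_mult [of p 1] by (auto simp: germ_unit_iff order_ge_def)
  moreover obtain k where k: "f = p * k" using pf by (rule dvdE)
  ultimately have "k dvd 1" using irreducibleD [OF f] by blast
  then obtain l where l: "1 = k * l" by (rule dvdE)
  have "p = f * l" unfolding k by (simp add: mult.assoc flip: l)
  then have fp: "f dvd p" by (rule dvdI)
  have "curve_mult p = curve_mult f"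
    using curve_mult_le_of_dvd [OF pf \<open>f \<noteq> 0\<close>] curve_mult_le_of_dvd [OF fp p(1)] by simp
  then show "regular_order (curve_mult f) h" using e p by simp
  show "h dvd blowup c g \<longleftrightarrow> f dvd g"
  proof
    assume "f dvd g"
    then obtain q where "g = f * q" by (rule dvdE)
    then show "h dvd blowup c g" using hf by (simp add: blowup_mult)
  qed (use p(3) fp dvd_trans in blast)
qed

text \<open>
  If \<open>f' = a b\<close> with nonunits \<open>a\<close> and \<open>b\<close>, then \<open>a\<close>, \<open>b\<close> and \<open>f'\<close> all have order \<open>curve_mult f\<close> in
  \<open>v\<close>, although the orders of \<open>a\<close> and \<open>b\<close> add up to that of \<open>f'\<close>.
\<close>

lemma irreducible_strict_transform:
  assumes f: "irreducible f" and f': "blowup c f = X ^ curve_mult f * f'"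
    and 0: "series f' $ 0 $ 0 = 0"
  shows "regular_order (curve_mult f) f'" and "f' dvd blowup c g \<longleftrightarrow> f dvd g"
    and "irreducible f'"
proof -
  have nonunit: "\<not> f' dvd 1" using 0 by (simp add: germ_unit_iff)
  note * = irreducible_strict_transform_factor [OF f f']
  show reg: "regular_order (curve_mult f) f'" and "f' dvd blowup c g \<longleftrightarrow> f dvd g"
    using * [OF dvd_refl nonunit] by auto
  show "irreducible f'"
  proof (rule irreducibleI)
    show "f' \<noteq> 0" using reg by (auto simp: regular_order_def zero_germ.rep_eq)
    show "\<not> f' dvd 1" by (rule nonunit)
    fix a b assume ab: "f' = a * b"
    show "a dvd 1 \<or> b dvd 1"
    proof (rule ccontr)
      assume "\<not> (a dvd 1 \<or> b dvd 1)"
      then have "regular_order (curve_mult f) a" "regular_order (curve_mult f) b"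
        using *(1) [of a] *(1) [of b] ab by simp_all
      moreover obtain m n where "regular_order m a" "regular_order n b" "curve_mult f = m + n"
        using reg regular_order_factors unfolding ab by metis
      ultimately have "curve_mult f = 0" by (auto simp: regular_order_iff_subdegree)
      then show False using reg nonunit by (simp add: germ_unit_iff_regular)
    qed
  qed
qed

section \<open>Exchanging the coordinates\<close>

lemma swap_swap [simp]: "swap (swap f) = f"
  by transfer (simp add: swap_series_def fps_eq_iff)

lemma swap_add: "swap (f + g) = swap f + swap g"
  by transfer (simp add: swap_series_def fps_eq_iff)

lemma swap_mult: "swap (f * g) = swap f * swap g"
proof (rule germ_eqI)
  fix i j
  have "series (swap (f * g)) $ i $ j
      = (\<Sum>a=0..j. \<Sum>b=0..i. series f $ a $ b * series g $ (j - a) $ (i - b))"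
    by (simp add: swap.rep_eq swap_series_def times_germ.rep_eq fps_mult_nth fps_sum_nth)
  also have "\<dots> = (\<Sum>b=0..i. \<Sum>a=0..j. series f $ a $ b * series g $ (j - a) $ (i - b))"
    by (rule sum.swap)
  also have "\<dots> = series (swap f * swap g) $ i $ j"
    by (simp add: swap.rep_eq swap_series_def times_germ.rep_eq fps_mult_nth fps_sum_nth)
  finally show "series (swap (f * g)) $ i $ j = series (swap f * swap g) $ i $ j" .
qed

lemma swap_const: "swap (const_germ a) = const_germ a"
  by transfer (auto simp: swap_series_def fps_eq_iff)

lemma swap_minus: "swap (- f) = - swap f"
  by transfer (simp add: swap_series_def fps_eq_iff)

lemma swap_diff: "swap (f - g) = swap f - swap g"
  using swap_add [of f "- g"] by (simp add: swap_minus)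

lemma swap_dvd_iff: "swap f dvd swap g \<longleftrightarrow> f dvd g"
  by (metis dvd_def swap_mult swap_swap)

lemma swap_eq_0_iff [simp]: "swap f = 0 \<longleftrightarrow> f = 0"
  by (metis const_germ_0 swap_const swap_swap)

lemma swap_dvd_1_iff [simp]: "swap f dvd 1 \<longleftrightarrow> f dvd 1"
  by (metis const_germ_1 swap_const swap_dvd_iff)

lemma irreducible_swap: "irreducible f \<Longrightarrow> irreducible (swap f)"
proof (rule irreducibleI)
  fix a b assume f: "irreducible f" and "swap f = a * b"
  then have "f = swap a * swap b" by (metis swap_mult swap_swap)
  then show "a dvd 1 \<or> b dvd 1" using irreducibleD [OF f] swap_dvd_1_iff by blast
qed (simp_all add: irreducible_def)

lemma curve_mult_swap: "curve_mult (swap f) = curve_mult f"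
proof -
  have "(\<exists>i j. i + j = n \<and> series (swap f) $ i $ j \<noteq> 0)
      = (\<exists>i j. i + j = n \<and> series f $ i $ j \<noteq> 0)" for n
    by (simp add: swap.rep_eq swap_series_def) (metis add.commute)
  then show ?thesis by (simp add: curve_mult_def)
qed

section \<open>Dimensions of quotients of the ring of germs\<close>

interpretation germ_space: vector_space "\<lambda>c g. const_germ c * g"
  by standard (simp_all add: const_germ_add const_germ_mult algebra_simps)

text \<open>
  The two halves of being a basis of \<open>W\<close> modulo \<open>I\<close>. Keeping them apart allows dimensions to be
  compared through spanning and independent sets alone, without naming quotient spaces.
\<close>

definition spans_mod :: "germ set \<Rightarrow> germ set \<Rightarrow> germ set \<Rightarrow> bool" where
  "spans_mod I W B \<longleftrightarrow> (\<forall>h\<in>W. \<exists>c. h - (\<Sum>b\<in>B. const_germ (c b) * b) \<in> I)"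

definition indep_mod :: "germ set \<Rightarrow> germ set \<Rightarrow> bool" where
  "indep_mod I B \<longleftrightarrow> (\<forall>c. (\<Sum>b\<in>B. const_germ (c b) * b) \<in> I \<longrightarrow> (\<forall>b\<in>B. c b = 0))"

lemma quotient_basis_iff:
  "quotient_basis I B \<longleftrightarrow> finite B \<and> spans_mod I UNIV B \<and> indep_mod I B"
  by (simp add: quotient_basis_def spans_mod_def indep_mod_def)

text \<open>
  Replacing every \<open>s\<close> by the combination of \<open>T\<close> to which it is congruent reduces this to the
  Steinitz bound: the replacements stay independent because \<open>S\<close> is independent modulo \<open>I\<close>.
\<close>

lemma indep_mod_card_le:
  assumes I: "germ_space.subspace I" and fin: "finite S" "finite T" and "S \<subseteq> W"
    and T: "spans_mod I W T" and S: "indep_mod I S"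
  shows "card S \<le> card T"
proof -
  have "\<forall>s\<in>S. \<exists>c. s - (\<Sum>b\<in>T. const_germ (c b) * b) \<in> I"
    using T \<open>S \<subseteq> W\<close> unfolding spans_mod_def by blast
  then obtain c where c: "\<And>s. s \<in> S \<Longrightarrow> s - (\<Sum>b\<in>T. const_germ (c s b) * b) \<in> I"
    by metis
  define t where "t = (\<lambda>s. \<Sum>b\<in>T. const_germ (c s b) * b)"
  have t: "s - t s \<in> I" if "s \<in> S" for s using c [OF that] by (simp add: t_def)
  have *: "\<forall>s\<in>S. a s = 0" if "(\<Sum>s\<in>S. const_germ (a s) * t s) = 0" for a
  proof -
    have "(\<Sum>s\<in>S. const_germ (a s) * s) = (\<Sum>s\<in>S. const_germ (a s) * (s - t s))"
      using that by (simp add: right_diff_distrib sum_subtractf)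
    also have "\<dots> \<in> I"
      by (intro germ_space.subspace_sum [OF I] germ_space.subspace_scale [OF I] t)
    finally show ?thesis using S unfolding indep_mod_def by blast
  qed
  \<comment> \<open>If \<open>t x = t y\<close>, then the coefficients \<open>1\<close> at \<open>x\<close> and \<open>-1\<close> at \<open>y\<close> give a vanishing combination.\<close>
  have inj: "inj_on t S"
  proof (rule inj_onI, rule ccontr)
    fix x y assume xy: "x \<in> S" "y \<in> S" "t x = t y" "x \<noteq> y"
    define a where "a = (\<lambda>s. (if s = x then 1 else 0) - (if s = y then 1 else 0 :: complex))"
    have "(\<Sum>s\<in>S. const_germ (a s) * t s)
        = (\<Sum>s\<in>S. (if s = x then t x else 0) - (if s = y then t y else 0))"
      by (intro sum.cong) (auto simp: a_def const_germ_diff const_germ_minus)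
    also have "\<dots> = 0" using fin xy by (simp add: sum_subtractf)
    finally have "a x = 0" using * xy(1) by blast
    then show False using xy by (simp add: a_def)
  qed
  have "germ_space.independent (t ` S)"
  proof
    assume "germ_space.dependent (t ` S)"
    then obtain u v where u: "v \<in> t ` S" "u v \<noteq> 0"
        "(\<Sum>v\<in>t ` S. const_germ (u v) * v) = 0"
      using germ_space.dependent_finite [of "t ` S"] fin by auto
    then have "(\<Sum>s\<in>S. const_germ (u (t s)) * t s) = 0"
      by (simp add: sum.reindex [OF inj])
    then show False using * [of "\<lambda>s. u (t s)"] u(1,2) by auto
  qed
  moreover have "t ` S \<subseteq> germ_space.span T"
    unfolding t_def
    by (auto intro!: germ_space.span_sum germ_space.span_scale intro: germ_space.span_base)
  ultimately have "card (t ` S) \<le> card T"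
    using germ_space.independent_span_bound [OF fin(2)] by blast
  then show ?thesis by (simp add: card_image [OF inj])
qed

lemma quotient_basis_card_unique:
  assumes "germ_space.subspace I" "quotient_basis I B" "quotient_basis I C"
  shows "card B = card C"
  using assms indep_mod_card_le [of I _ _ UNIV] unfolding quotient_basis_iff
  by (meson order_antisym subset_UNIV)

lemma subspace_ideal: "germ_space.subspace {f * a + g * b | a b. True}"
  unfolding germ_space.subspace_def
proof (intro conjI ballI allI)
  let ?I = "{f * a + g * b | a b. True}"
  show "0 \<in> ?I" by (rule CollectI, rule exI [of _ 0], rule exI [of _ 0]) simp
  fix x y assume "x \<in> ?I" "y \<in> ?I"
  then obtain a b c d where "x = f * a + g * b" "y = f * c + g * d" by blast
  then have "x + y = f * (a + c) + g * (b + d)" by (simp add: algebra_simps)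
  then show "x + y \<in> ?I" by blast
next
  let ?I = "{f * a + g * b | a b. True}"
  fix c x assume "x \<in> ?I"
  then obtain a b where "x = f * a + g * b" by blast
  then have "const_germ c * x = f * (const_germ c * a) + g * (const_germ c * b)"
    by (simp add: algebra_simps)
  then show "const_germ c * x \<in> ?I" by blast
qed

lemma intersection_mult_eqI:
  assumes "quotient_basis {f * a + g * b | a b. True} B"
  shows "intersection_mult f g = card B"
  unfolding intersection_mult_def
proof (rule the_equality)
  show "\<exists>C. quotient_basis {f * a + g * b | a b. True} C \<and> card C = card B"
    using assms by blast
  show "n = card B" if "\<exists>C. quotient_basis {f * a + g * b | a b. True} C \<and> card C = n" for n
    using that quotient_basis_card_unique [OF subspace_ideal _ assms] by blast
qed

lemma indep_mod_disjoint:
  assumes "germ_space.subspace U" "indep_mod U B" "finite B" "C \<subseteq> U"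
  shows "B \<inter> C = {}"
proof (rule ccontr)
  assume "B \<inter> C \<noteq> {}"
  then obtain x where x: "x \<in> B" "x \<in> U" using assms(4) by auto
  have "(\<Sum>b\<in>B. const_germ (if b = x then 1 else 0) * b) = (\<Sum>b\<in>B. if b = x then x else 0)"
    by (intro sum.cong) auto
  then have "(\<Sum>b\<in>B. const_germ (if b = x then 1 else 0) * b) = x" using x assms(3) by simp
  then show False
    using assms(2) [unfolded indep_mod_def, rule_format, of "\<lambda>b. if b = x then 1 else 0" x] x by simp
qed

lemma spans_mod_chain:
  assumes "spans_mod U W B" "spans_mod I U C" "finite B" "finite C" "B \<inter> C = {}"
  shows "spans_mod I W (B \<union> C)"
  unfolding spans_mod_def
proof
  fix h assume "h \<in> W"
  then obtain c where "h - (\<Sum>b\<in>B. const_germ (c b) * b) \<in> U"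
    using assms(1) unfolding spans_mod_def by blast
  then obtain d where
    d: "h - (\<Sum>b\<in>B. const_germ (c b) * b) - (\<Sum>b\<in>C. const_germ (d b) * b) \<in> I"
    using assms(2) unfolding spans_mod_def by blast
  define e where "e = (\<lambda>b. if b \<in> B then c b else d b)"
  have "(\<Sum>b\<in>B. const_germ (e b) * b) = (\<Sum>b\<in>B. const_germ (c b) * b)"
    by (intro sum.cong) (auto simp: e_def)
  moreover have "(\<Sum>b\<in>C. const_germ (e b) * b) = (\<Sum>b\<in>C. const_germ (d b) * b)"
    using assms(5) by (intro sum.cong) (auto simp: e_def)
  ultimately have "h - (\<Sum>b\<in>B \<union> C. const_germ (e b) * b) \<in> I"
    using d assms(3-5) by (simp add: sum.union_disjoint diff_diff_eq)
  then show "\<exists>c. h - (\<Sum>b\<in>B \<union> C. const_germ (c b) * b) \<in> I" by blast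
qed

lemma indep_mod_chain:
  assumes U: "germ_space.subspace U" and "I \<subseteq> U" and C: "C \<subseteq> U"
    and "indep_mod U B" "indep_mod I C" "finite B" "finite C"
  shows "indep_mod I (B \<union> C)"
  unfolding indep_mod_def
proof (intro allI impI)
  fix c assume "(\<Sum>b\<in>B \<union> C. const_germ (c b) * b) \<in> I"
  moreover have "B \<inter> C = {}" using indep_mod_disjoint assms by blast
  ultimately have I: "(\<Sum>b\<in>B. const_germ (c b) * b) + (\<Sum>b\<in>C. const_germ (c b) * b) \<in> I"
    using assms(6,7) by (simp add: sum.union_disjoint)
  have "(\<Sum>b\<in>C. const_germ (c b) * b) \<in> U"
    using C by (intro germ_space.subspace_sum [OF U] germ_space.subspace_scale [OF U]) auto
  then have "(\<Sum>b\<in>B. const_germ (c b) * b) \<in> U"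
    using germ_space.subspace_diff [OF U] I \<open>I \<subseteq> U\<close> by (metis add_diff_cancel_right' subsetD)
  then have B: "\<forall>b\<in>B. c b = 0" using assms(4) unfolding indep_mod_def by blast
  then have "(\<Sum>b\<in>C. const_germ (c b) * b) \<in> I" using I by simp
  then have "\<forall>b\<in>C. c b = 0" using assms(5) unfolding indep_mod_def by blast
  then show "\<forall>b\<in>B \<union> C. c b = 0" using B by blast
qed

lemma subspace_order_ge: "germ_space.subspace {g. order_ge a g}"
  by (auto simp: germ_space.subspace_def order_ge_def nth_const_mult series_simps)

text \<open>
  The monomials \<open>x^i y^j\<close> with \<open>i + j < a\<close> form the basis.
\<close>

lemma order_ge_quotient_basis:
  obtains M where "quotient_basis {g. order_ge a g} M" "2 * card M = a * (a + 1)"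
proof -
  define T where "T = (SIGMA i:{..<a}. {..<a - i})"
  have T: "(i, j) \<in> T \<longleftrightarrow> i + j < a" for i j by (auto simp: T_def)
  have fin: "finite T" by (simp add: T_def)
  define m where "m = (\<lambda>(i, j). X ^ i * Y ^ j)"
  have nth_m: "series (m p) $ k $ l = (if p = (k, l) then 1 else 0)" for p k l
    by (cases p) (auto simp: m_def series_simps fps_const_power fps_X_power_mult_nth)
  have inj: "inj_on m T"
    by (rule inj_onI) (metis nth_m prod.collapse zero_neq_one)
  have sum: "series (\<Sum>b\<in>m ` T. const_germ (c b) * b) $ k $ l
      = (if k + l < a then c (m (k, l)) else 0)" for c k l
  proof -
    have "series (\<Sum>b\<in>m ` T. const_germ (c b) * b) $ k $ l
        = (\<Sum>p\<in>T. if p = (k, l) then c (m (k, l)) else 0)"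
      unfolding sum.reindex [OF inj] series_sum fps_sum_nth o_def nth_const_mult nth_m
      by (intro sum.cong) auto
    then show ?thesis using fin by (simp add: T)
  qed
  have "spans_mod {g. order_ge a g} UNIV (m ` T)"
    unfolding spans_mod_def
  proof
    fix h
    define c where "c = (\<lambda>b. let p = inv_into T m b in series h $ fst p $ snd p)"
    have "c (m (k, l)) = series h $ k $ l" if "k + l < a" for k l
      using that by (simp add: c_def inv_into_f_f [OF inj] T)
    then have "order_ge a (h - (\<Sum>b\<in>m ` T. const_germ (c b) * b))"
      by (simp add: order_ge_def minus_germ.rep_eq sum)
    then show "\<exists>c. h - (\<Sum>b\<in>m ` T. const_germ (c b) * b) \<in> {g. order_ge a g}" by blast
  qed
  moreover have "indep_mod {g. order_ge a g} (m ` T)"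
    unfolding indep_mod_def
  proof (intro allI impI, safe)
    fix c i j assume "order_ge a (\<Sum>b\<in>m ` T. const_germ (c b) * b)" "(i, j) \<in> T"
    then show "c (m (i, j)) = 0" unfolding order_ge_def sum T by (metis (full_types))
  qed
  moreover have "2 * card (m ` T) = a * (a + 1)"
  proof -
    have "card (m ` T) = (\<Sum>i<a. a - i)"
      unfolding card_image [OF inj] by (simp add: T_def)
    also have "\<dots> = (\<Sum>i<a. Suc i)"
      using sum.nat_diff_reindex [of Suc a] by (simp add: Suc_diff_Suc)
    also have "2 * (\<Sum>i<a. Suc i) = a * (a + 1)" by (induction a) auto
    finally show ?thesis .
  qed
  ultimately show thesis using that [of "m ` T"] fin by (simp add: quotient_basis_iff)
qed

section \<open>Valuations of branches\<close>

text \<open>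
  What is needed of the intersection multiplicity with an irreducible germ \<open>f\<close>: it is a valuation of
  the ring modulo \<open>f\<close> with residue field the complex numbers (\<open>v_leaf\<close>), whose value semigroup has
  a finite complement, and every element of sufficiently large value relative to \<open>g\<close> is a multiple of
  \<open>g\<close> modulo \<open>f\<close> (\<open>v_conductor\<close>). The last two properties replace the normalization of the branch.
\<close>

locale branch_valuation =
  fixes f :: germ and v :: "germ \<Rightarrow> enat"
  assumes v_eq_infinity_iff: "v g = \<infinity> \<longleftrightarrow> f dvd g"
    and v_mult: "v (g * h) = v g + v h"
    and v_add: "min (v g) (v h) \<le> v (g + h)"
    and v_leaf: "v g = v h \<Longrightarrow> v h \<noteq> \<infinity> \<Longrightarrow> \<exists>c. v g < v (g - const_germ c * h)"
    and v_all_large: "\<exists>N. \<forall>s\<ge>N. \<exists>g. v g = enat s"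
    and v_conductor: "\<exists>N. \<forall>g h. v g + enat N \<le> v h \<longrightarrow> (\<exists>a b. h = f * a + g * b)"
begin

lemma v_1: "v 1 = 0"
proof -
  obtain g s where "v g = enat s" using v_all_large by blast
  then show ?thesis using v_mult [of 1 g] by (cases "v 1") (auto simp: zero_enat_def)
qed

lemma v_unit: "g dvd 1 \<Longrightarrow> v g = 0"
  using v_1 v_mult by (metis add_eq_0_iff_both_eq_0 dvdE zero_le)

lemma v_const_mult: "c \<noteq> 0 \<Longrightarrow> v (const_germ c * g) = v g"
  using v_unit [of "const_germ c"] const_germ_inverse [of c] by (simp add: v_mult dvdI)

lemma v_0: "v 0 = \<infinity>"
  by (simp add: v_eq_infinity_iff)

lemma v_const_mult_ge: "v g \<le> v (const_germ c * g)"
  by (cases "c = 0") (simp_all add: v_0 v_const_mult)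

lemma v_minus: "v (- g) = v g"
  using v_const_mult [of "-1" g] by (simp add: const_germ_minus)

lemma v_diff: "min (v g) (v h) \<le> v (g - h)"
  using v_add [of g "- h"] by (simp add: v_minus)

lemma v_add_eq:
  assumes "v g < v h"
  shows "v (g + h) = v g"
proof (rule order_antisym)
  show "v g \<le> v (g + h)" using v_add [of g h] assms by simp
  show "v (g + h) \<le> v g" using v_diff [of "g + h" h] assms
    by (simp add: min_le_iff_disj not_le [symmetric])
qed

lemma subspace_v_ge: "germ_space.subspace {g. k \<le> v g}"
  unfolding germ_space.subspace_def
  by (auto simp: v_0 intro: order.trans [OF min.boundedI v_add] order.trans [OF _ v_const_mult_ge])

lemma v_sum_gt:
  assumes "finite S" "\<And>s. s \<in> S \<Longrightarrow> enat k < v (g s)"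
  shows "enat k < v (\<Sum>s\<in>S. g s)"
  using assms
proof (induction S)
  case (insert s S)
  then have "enat k < min (v (g s)) (v (\<Sum>s\<in>S. g s))" by simp
  also have "\<dots> \<le> v (g s + (\<Sum>s\<in>S. g s))" by (rule v_add)
  finally show ?case using insert by simp
qed (simp add: v_0)

definition v_values :: "germ set \<Rightarrow> nat set" where
  "v_values W = {s. \<exists>w\<in>W. v w = enat s}"

text \<open>
  As \<open>v_leaf\<close> lets two elements of equal value cancel up to higher value, elements with pairwise
  distinct values from \<open>v_values W - v_values I\<close> form a basis of \<open>W\<close> modulo \<open>I\<close>: subtracting multiples
  of them, or of elements of \<open>I\<close>, raises the value of \<open>w\<close> until \<open>w\<close> lies in \<open>I\<close>; and a nontrivial
  combination has the least of the values that occur in it, which is not a value on \<open>I\<close>.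
\<close>

lemma quotient_dimension_eq_card_values:
  assumes W: "germ_space.subspace W" and I: "germ_space.subspace I" "I \<subseteq> W"
    and K: "\<And>w. w \<in> W \<Longrightarrow> enat K \<le> v w \<Longrightarrow> w \<in> I"
  obtains B where "finite B" "B \<subseteq> W" "spans_mod I W B" "indep_mod I B"
    "card B = card (v_values W - v_values I)"
proof -
  define S where "S = v_values W - v_values I"
  have "S \<subseteq> {..<K}"
    using K by (force simp: S_def v_values_def not_less [symmetric] enat_ord_simps)
  then have fin: "finite S" using finite_subset by blast
  have "\<forall>s\<in>S. \<exists>w. w \<in> W \<and> v w = enat s" by (auto simp: S_def v_values_def)
  then obtain b where b: "\<And>s. s \<in> S \<Longrightarrow> b s \<in> W" "\<And>s. s \<in> S \<Longrightarrow> v (b s) = enat s"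
    by metis
  have inj: "inj_on b S" by (rule inj_onI) (metis b(2) enat.inject)
  define L where "L = (\<lambda>c. \<Sum>s\<in>S. const_germ (c s) * b s)"
  \<comment> \<open>Induction on \<open>n\<close>, the distance from the value \<open>K\<close> from which on everything lies in \<open>I\<close>.\<close>
  have spans: "\<exists>c. w - L c \<in> I" if "w \<in> W" "enat (K - n) \<le> v w" for w n
    using that
  proof (induction n arbitrary: w)
    case 0
    then have "w - L (\<lambda>_. 0) \<in> I" using K by (simp add: L_def)
    then show ?case by blast
  next
    case (Suc n)
    show ?case
    proof (cases "enat (K - n) \<le> v w")
      case True
      then show ?thesis using Suc by blast
    next
      case False
      define s where "s = K - Suc n"
      have s: "v w = enat s" "K - n = Suc s"
        using False Suc.prems(2) unfolding s_def by (cases "v w"; auto)+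
      have up: "enat (K - n) \<le> v (w - const_germ a * g)" if "v w < v (w - const_germ a * g)" for a g
        using that s by (cases "v (w - const_germ a * g)") auto
      show ?thesis
      proof (cases "s \<in> S")
        case True
        then obtain a where a: "v w < v (w - const_germ a * b s)"
          using v_leaf [of w "b s"] b s by auto
        have "w - const_germ a * b s \<in> W"
          using W Suc.prems(1) b(1) [OF True]
          by (simp add: germ_space.subspace_diff germ_space.subspace_scale)
        then obtain c where c: "w - const_germ a * b s - L c \<in> I"
          using Suc.IH up [OF a] by blast
        have "L (c(s := c s + a)) = (\<Sum>t\<in>S. const_germ (c t) * b t
            + (if t = s then const_germ a * b s else 0))"
          unfolding L_def by (intro sum.cong) (auto simp: const_germ_add distrib_right)
        also have "\<dots> = L c + const_germ a * b s"
          using True fin by (simp add: L_def sum.distrib)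
        finally have "w - L (c(s := c s + a)) = w - const_germ a * b s - L c"
          by (simp add: algebra_simps)
        then show ?thesis using c by metis
      next
        case False
        then obtain i where i: "i \<in> I" "v i = enat s"
          using Suc.prems(1) s by (auto simp: S_def v_values_def)
        then obtain a where a: "v w < v (w - const_germ a * i)"
          using v_leaf [of w i] s by auto
        have "w - const_germ a * i \<in> W"
          using W Suc.prems(1) i I
          by (auto intro!: germ_space.subspace_diff germ_space.subspace_scale)
        then obtain c where c: "w - const_germ a * i - L c \<in> I"
          using Suc.IH up [OF a] by blast
        have "(w - const_germ a * i - L c) + const_germ a * i \<in> I"
          using c i I by (intro germ_space.subspace_add germ_space.subspace_scale)
        then show ?thesis by (intro exI [of _ c]) (simp add: algebra_simps)
      qed
    qed
  qed
  have indep: "\<forall>s\<in>S. c s = 0" if "L c \<in> I" for c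
  proof (rule ccontr)
    define T where "T = {s \<in> S. c s \<noteq> 0}"
    assume "\<not> (\<forall>s\<in>S. c s = 0)"
    then have "T \<noteq> {}" "finite T" using fin by (auto simp: T_def)
    define m where "m = Min T"
    have m: "m \<in> S" "c m \<noteq> 0"
      using Min_in [OF \<open>finite T\<close> \<open>T \<noteq> {}\<close>] by (auto simp: m_def T_def)
    have "enat m < v (const_germ (c s) * b s)" if "s \<in> S - {m}" for s
    proof (cases "c s = 0")
      case False
      then have "m \<le> s" using that \<open>finite T\<close> by (simp add: m_def T_def)
      then show ?thesis using that False b by (auto simp: v_const_mult)
    qed (simp add: v_0)
    then have "enat m < v (\<Sum>s\<in>S - {m}. const_germ (c s) * b s)"
      using fin by (intro v_sum_gt) auto
    moreover have "L c = const_germ (c m) * b m + (\<Sum>s\<in>S - {m}. const_germ (c s) * b s)"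
      unfolding L_def by (rule sum.remove [OF fin m(1)])
    ultimately have "v (L c) = enat m"
      using m b v_add_eq by (simp add: v_const_mult)
    then show False using m(1) that by (auto simp: S_def v_values_def)
  qed
  have LB: "(\<Sum>x\<in>b ` S. const_germ (c x) * x) = L (c \<circ> b)" for c
    by (simp add: sum.reindex [OF inj] L_def)
  show thesis
  proof
    show "finite (b ` S)" "b ` S \<subseteq> W" using fin b by auto
    show "card (b ` S) = card (v_values W - v_values I)"
      unfolding card_image [OF inj] by (simp add: S_def)
    show "indep_mod I (b ` S)"
      unfolding indep_mod_def LB using indep by fastforce
    show "spans_mod I W (b ` S)"
      unfolding spans_mod_def LB
    proof
      fix h assume "h \<in> W"
      then obtain c where c: "h - L c \<in> I" 
        using spans [of h K] by (auto simp flip: zero_enat_def)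
      have "L ((c \<circ> inv_into S b) \<circ> b) = L c"
        unfolding L_def by (intro sum.cong) (auto simp: inv_into_f_f [OF inj])
      then show "\<exists>c. h - L (c \<circ> b) \<in> I" using c by metis
    qed
  qed
qed

end

text \<open>
  Below a large bound, \<open>\<Gamma>\<close> has \<open>m\<close> elements more than its translate, and above it they agree.
\<close>

lemma card_diff_translate:
  fixes \<Gamma> :: "nat set"
  assumes N: "\<And>s. s \<ge> N \<Longrightarrow> s \<in> \<Gamma>" and sub: "(+) m ` \<Gamma> \<subseteq> \<Gamma>"
  shows "card (\<Gamma> - (+) m ` \<Gamma>) = m"
proof -
  define A where "A = \<Gamma> \<inter> {..<N}"
  have "\<Gamma> - (+) m ` \<Gamma> = (A \<union> {N..<N + m}) - (+) m ` A"
  proof (intro equalityI subsetI)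
    fix s assume s: "s \<in> \<Gamma> - (+) m ` \<Gamma>"
    have "s < N + m"
    proof (rule ccontr)
      assume "\<not> s < N + m"
      then have "s - m \<in> \<Gamma>" "s = m + (s - m)" using N by auto
      then show False using s by blast
    qed
    then show "s \<in> (A \<union> {N..<N + m}) - (+) m ` A" using s by (auto simp: A_def)
  next
    fix s assume s: "s \<in> (A \<union> {N..<N + m}) - (+) m ` A"
    then have "s \<in> \<Gamma>" "s < N + m" using N by (auto simp: A_def)
    moreover have "s \<notin> (+) m ` \<Gamma>"
    proof
      assume "s \<in> (+) m ` \<Gamma>"
      then show False using s \<open>s < N + m\<close> by (auto simp: A_def)
    qed
    ultimately show "s \<in> \<Gamma> - (+) m ` \<Gamma>" by simp
  qed
  moreover have "(+) m ` A \<subseteq> A \<union> {N..<N + m}"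
    using sub by (auto simp: A_def)
  moreover have "finite A" by (simp add: A_def)
  moreover have "card (A \<union> {N..<N + m}) = card A + m"
    using \<open>finite A\<close> by (subst card_Un_disjoint) (auto simp: A_def)
  moreover have "card ((+) m ` A) = card A" by (simp add: card_image)
  ultimately show ?thesis by (simp add: card_Diff_subset)
qed

context branch_valuation
begin

text \<open>
  Elements of the ideal \<open>(f, g)\<close> have the value of a multiple of \<open>g\<close>, so that the values on the ideal
  are the translate of the semigroup by \<open>v g\<close>; exactly \<open>v g\<close> values are missing.
\<close>

lemma intersection_mult_eq:
  assumes "v g = enat m"
  shows "intersection_mult f g = m"
proof -
  define I where "I = {f * a + g * b | a b. True}"
  have I: "germ_space.subspace I" unfolding I_def by (rule subspace_ideal)
  obtain N where N: "\<And>h. v g + enat N \<le> v h \<Longrightarrow> h \<in> I"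
    using v_conductor unfolding I_def by blast
  have "v (f * a + g * b) = enat m + v b" for a b
  proof (cases "v (g * b) = \<infinity>")
    case True
    then have "f dvd g * b" by (simp add: v_eq_infinity_iff)
    then have "v (f * a + g * b) = \<infinity>" by (simp add: v_eq_infinity_iff)
    then show ?thesis using True assms by (simp add: v_mult)
  next
    case False
    have "v (f * a) = \<infinity>" by (simp add: v_eq_infinity_iff)
    then have "v (g * b + f * a) = v (g * b)" using False by (intro v_add_eq) auto
    then show ?thesis using assms by (simp add: v_mult add.commute)
  qed
  then have vals: "v_values I = (+) m ` v_values UNIV"
  proof (intro equalityI subsetI)
    fix s assume v: "\<And>a b. v (f * a + g * b) = enat m + v b" and "s \<in> v_values I"
    then obtain a b where "v (f * a + g * b) = enat s" unfolding v_values_def I_def by blast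
    then have "enat m + v b = enat s" using v by simp
    then show "s \<in> (+) m ` v_values UNIV" by (cases "v b") (auto simp: v_values_def)
  next
    fix s assume v: "\<And>a b. v (f * a + g * b) = enat m + v b" and "s \<in> (+) m ` v_values UNIV"
    then obtain b t where "s = m + t" "v b = enat t" by (auto simp: v_values_def)
    then have "v (f * 0 + g * b) = enat s" using v [of 0 b] by simp
    then show "s \<in> v_values I" unfolding v_values_def I_def by blast
  qed
  have sub: "(+) m ` v_values UNIV \<subseteq> v_values UNIV"
    unfolding vals [symmetric] by (auto simp: v_values_def)
  obtain M where "\<And>s. s \<ge> M \<Longrightarrow> s \<in> v_values UNIV"
    using v_all_large by (auto simp: v_values_def)
  then have card: "card (v_values UNIV - v_values I) = m"
    unfolding vals using sub by (rule card_diff_translate)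
  obtain B where B: "finite B" "spans_mod I UNIV B" "indep_mod I B"
    "card B = card (v_values UNIV - v_values I)"
    using quotient_dimension_eq_card_values [of UNIV I "m + N"] I N assms by auto
  have "quotient_basis I B" "card B = m"
    using B card by (auto simp: quotient_basis_iff)
  then show ?thesis unfolding I_def using intersection_mult_eqI by blast
qed

lemma curve_semigroup_eq: "curve_semigroup f = v_values UNIV"
proof -
  have "\<not> f dvd g \<longleftrightarrow> v g = enat (intersection_mult f g)" for g
  proof (cases "v g")
    case (enat m)
    then show ?thesis using intersection_mult_eq v_eq_infinity_iff [of g] by simp
  qed (use v_eq_infinity_iff [of g] in simp)
  then show ?thesis unfolding curve_semigroup_def v_values_def
    using intersection_mult_eq by auto
qed

lemma v_values_v_ge: "v_values {g. enat k \<le> v g} = {s \<in> v_values UNIV. k \<le> s}"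
proof -
  have "enat k \<le> v g \<and> v g = enat s \<longleftrightarrow> v g = enat s \<and> k \<le> s" for g s by auto
  then show ?thesis unfolding v_values_def by blast
qed

end

lemma branch_valuation_swap:
  assumes "branch_valuation (swap f) v"
  shows "branch_valuation f (\<lambda>g. v (swap g))"
proof -
  interpret branch_valuation "swap f" v by (rule assms)
  show ?thesis
  proof
    show "v (swap g) = \<infinity> \<longleftrightarrow> f dvd g" for g
      by (simp add: v_eq_infinity_iff swap_dvd_iff)
    show "\<exists>N. \<forall>s\<ge>N. \<exists>g. v (swap g) = enat s"
      using v_all_large by (metis swap_swap)
    obtain N where N: "\<And>g h. v g + enat N \<le> v h \<Longrightarrow> \<exists>a b. h = swap f * a + g * b"
      using v_conductor by blast
    show "\<exists>N. \<forall>g h. v (swap g) + enat N \<le> v (swap h) \<longrightarrow> (\<exists>a b. h = f * a + g * b)"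
      using N by (metis swap_add swap_mult swap_swap)
    show "\<exists>c. v (swap g) < v (swap (g - const_germ c * h))"
      if "v (swap g) = v (swap h)" "v (swap h) \<noteq> \<infinity>" for g h
      using v_leaf [OF that] by (simp add: swap_diff swap_mult swap_const)
  qed (simp_all add: swap_mult swap_add v_mult v_add)
qed

section \<open>Smooth branches\<close>

lemma y_degree_below_1_row:
  "y_degree_below 1 r \<Longrightarrow> series r $ i = fps_const (series r $ i $ 0)"
  by (intro fps_ext) (auto simp: y_degree_below_def)

text \<open>
  Modulo a germ \<open>f\<close> that is regular of order \<open>1\<close> in \<open>y\<close>, every germ is congruent to a unique series
  \<open>R g\<close> in \<open>x\<close> alone, and \<open>R\<close> is a ring homomorphism; the valuation is the order of \<open>R g\<close>.
\<close>

lemma branch_valuation_smooth: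
  assumes f: "regular_order 1 f"
  obtains v where "branch_valuation f v" "\<And>s. \<exists>g. v g = enat s"
proof -
  have "\<forall>g. \<exists>r. f dvd g - r \<and> y_degree_below 1 r"
  proof
    fix g
    obtain q r where "g = q * f + r" "y_degree_below 1 r"
      using weierstrass_division [OF f] by blast
    then show "\<exists>r. f dvd g - r \<and> y_degree_below 1 r"
      by (intro exI [of _ r]) simp
  qed
  then obtain R where R: "\<And>g. f dvd g - R g" "\<And>g. y_degree_below 1 (R g)" by metis
  have uniq: "R g = r" if "f dvd g - r" "y_degree_below 1 r" for g r
  proof -
    have "f dvd (g - r) - (g - R g)" using that(1) R(1) by (rule dvd_diff)
    moreover have "y_degree_below 1 (R g - r)"
      using that(2) R(2) [of g] by (simp add: y_degree_below_def minus_germ.rep_eq)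
    ultimately show ?thesis using weierstrass_unique [OF f, of "R g - r"] by simp
  qed
  have R_add: "R (g + h) = R g + R h" for g h
  proof (rule uniq)
    show "f dvd g + h - (R g + R h)"
      using dvd_add [OF R(1) [of g] R(1) [of h]] by (simp add: algebra_simps)
    show "y_degree_below 1 (R g + R h)"
      using R(2) [of g] R(2) [of h] by (simp add: y_degree_below_def plus_germ.rep_eq)
  qed
  have R_mult: "R (g * h) = R g * R h" for g h
  proof (rule uniq)
    have "f dvd (g - R g) * h + R g * (h - R h)" using R(1) by simp
    then show "f dvd g * h - R g * R h" by (simp add: algebra_simps)
    have "series (R g * R h) $ i = fps_const (\<Sum>a=0..i. series (R g) $ a $ 0 * series (R h) $ (i - a) $ 0)"
      for i
    proof -
      have "series (R g * R h) $ i = (\<Sum>a=0..i. series (R g) $ a * series (R h) $ (i - a))"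
        by (simp add: times_germ.rep_eq fps_mult_nth)
      also have "\<dots> = (\<Sum>a=0..i. fps_const (series (R g) $ a $ 0) * fps_const (series (R h) $ (i - a) $ 0))"
        by (intro sum.cong refl arg_cong2 [of _ _ _ _ "(*)"] y_degree_below_1_row R(2))
      finally show ?thesis by (simp add: fps_const_sum)
    qed
    then show "y_degree_below 1 (R g * R h)" by (simp add: y_degree_below_def)
  qed
  have R_const: "R (const_germ c) = const_germ c" for c
    by (rule uniq) (auto simp: y_degree_below_def const_germ.rep_eq)
  have R_diff: "R (g - const_germ c * h) = R g - const_germ c * R h" for g h c
  proof -
    have "R (g + const_germ (- c) * h) = R g + const_germ (- c) * R h"
      by (simp only: R_add R_mult R_const)
    then show ?thesis by (simp add: const_germ_minus)
  qed
  have R_X: "R (X ^ s) = X ^ s" for s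
    by (rule uniq) (auto simp: y_degree_below_def series_simps fps_X_power_nth)
  have R_0: "R g = 0 \<longleftrightarrow> f dvd g" for g
  proof
    assume "R g = 0" then show "f dvd g" using R(1) [of g] by simp
  next
    assume "f dvd g" then show "R g = 0"
      by (intro uniq) (auto simp: y_degree_below_def zero_germ.rep_eq)
  qed
  have ser0: "series g = 0 \<longleftrightarrow> g = 0" for g by (metis series_inject zero_germ.rep_eq)
  define v where "v = (\<lambda>g. if f dvd g then \<infinity> else enat (subdegree (series (R g))))"
  have v: "v g = enat (subdegree (series (R g)))" "series (R g) \<noteq> 0" if "\<not> f dvd g" for g
    using that by (auto simp: v_def ser0 R_0)
  have v_ge: "enat n \<le> v g \<longleftrightarrow> X ^ n dvd R g" for n g
  proof (cases "f dvd g")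
    case True
    then have "R g = 0" by (simp add: R_0)
    then show ?thesis using True by (simp add: v_def)
  next
    case False
    then have "series (R g) \<noteq> 0" by (rule v)
    then have "n \<le> subdegree (series (R g)) \<longleftrightarrow> (\<forall>i<n. series (R g) $ i = 0)"
      using subdegree_geI [of "series (R g)" n] nth_less_subdegree_zero [of _ "series (R g)"]
      by (meson order_less_le_trans)
    then show ?thesis using v(1) [OF False] by (simp add: X_power_dvd_iff)
  qed
  have v_X: "v (X ^ s) = enat s" for s
  proof -
    have "\<not> f dvd X ^ s" using R_0 [of "X ^ s"] by (simp add: R_X X_nonzero)
    then show ?thesis using v by (simp add: R_X series_simps)
  qed
  have "branch_valuation f v"
  proof
    show "v g = \<infinity> \<longleftrightarrow> f dvd g" for g by (simp add: v_def)
    show "v (g * h) = v g + v h" for g h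
    proof (cases "f dvd g \<or> f dvd h")
      case True
      then have "f dvd g * h" by auto
      then show ?thesis using True by (auto simp: v_def)
    next
      case False
      then have "\<not> f dvd g * h" using R_0 R_mult by (metis mult_eq_0_iff)
      then show ?thesis using False v
        by (simp add: R_mult times_germ.rep_eq subdegree_mult)
    qed
    show "min (v g) (v h) \<le> v (g + h)" for g h
    proof (cases "min (v g) (v h)")
      case (enat n)
      then have "enat n \<le> v g" "enat n \<le> v h" by (metis min.cobounded1, metis min.cobounded2)
      then show ?thesis unfolding enat v_ge R_add by (rule dvd_add)
    qed (auto simp: v_def min_def split: if_splits)
    show "\<exists>c. v g < v (g - const_germ c * h)" if gh: "v g = v h" "v h \<noteq> \<infinity>" for g h
    proof -
      obtain n where n: "v g = enat n" "v h = enat n" using gh by auto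
      then have g: "X ^ n dvd R g" and h: "X ^ n dvd R h" using v_ge by (metis order_refl)+
      have "\<not> X ^ Suc n dvd R h" using n v_ge [of "Suc n" h] by simp
      then have "series (R h) $ n \<noteq> 0"
        using h unfolding X_power_dvd_iff by (metis less_antisym)
      then have b: "series (R h) $ n $ 0 \<noteq> 0"
        using y_degree_below_1_row [OF R(2), of h n] by force
      \<comment> \<open>The quotient of the leading coefficients: subtracting cancels the term \<open>x^n\<close>.\<close>
      define c where "c = series (R g) $ n $ 0 / series (R h) $ n $ 0"
      have "series (R (g - const_germ c * h)) $ i = 0" if "i < Suc n" for i
      proof (rule fps_ext)
        fix j
        have "series (R (g - const_germ c * h)) $ i $ j
            = series (R g) $ i $ j - c * series (R h) $ i $ j"
          by (simp add: R_diff minus_germ.rep_eq nth_const_mult)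
        also have "\<dots> = 0"
        proof (cases "j = 0 \<and> i = n")
          case True
          then show ?thesis using b by (simp add: c_def)
        next
          case False
          then have "series (R k) $ i $ j = 0" if "X ^ n dvd R k" for k
            using \<open>i < Suc n\<close> that R(2) [of k] unfolding X_power_dvd_iff y_degree_below_def
            by (cases "i < n") auto
          then show ?thesis using g h by simp
        qed
        finally show "series (R (g - const_germ c * h)) $ i $ j = 0 $ j" by simp
      qed
      then have "enat (Suc n) \<le> v (g - const_germ c * h)" unfolding v_ge X_power_dvd_iff by blast
      then have "v g < v (g - const_germ c * h)"
        using n by (metis Suc_ile_eq)
      then show ?thesis by blast
    qed
    show "\<exists>N. \<forall>s\<ge>N. \<exists>g. v g = enat s"
      using v_X by blast
    have "\<exists>a b. h = f * a + g * b" if "v g + enat 0 \<le> v h" for g h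
    proof (cases "f dvd g")
      case True
      then have "f dvd h" using that by (auto simp: v_def split: if_splits)
      then obtain a where "h = f * a + g * 0" by (auto elim: dvdE)
      then show ?thesis by blast
    next
      case False
      then obtain n where n: "v g = enat n" using v by blast
      then have "X ^ n dvd R g" "\<not> X ^ Suc n dvd R g" "X ^ n dvd R h"
        using v_ge [of n g] v_ge [of "Suc n" g] v_ge [of n h] that by (simp_all add: zero_enat_def [symmetric])
      then obtain w s where w: "R g = X ^ n * w" and s: "R h = X ^ n * s" by (auto elim!: dvdE)
      have row: "series w $ 0 = fps_const (series w $ 0 $ 0)"
        using y_degree_below_1_row [OF R(2) [of g], of n] by (simp add: w nth_X_power_mult)
      have "w dvd 1"
      proof (rule ccontr)
        assume "\<not> w dvd 1"
        then have "series w $ 0 = 0" using row by (simp add: germ_unit_iff)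
        then have "X ^ 1 dvd w" unfolding X_power_dvd_iff by simp
        then have "X ^ Suc n dvd R g" unfolding w power_Suc2 by (intro mult_dvd_mono) auto
        then show False using \<open>\<not> X ^ Suc n dvd R g\<close> by blast
      qed
      then obtain u where u: "1 = w * u" by (rule dvdE)
      have "R h = R g * (u * s)" unfolding w s by (metis mult.assoc mult.right_neutral u)
      then have "h - g * (u * s) = (h - R h) - (g - R g) * (u * s)" by (simp add: algebra_simps)
      also have "f dvd \<dots>" by (rule dvd_diff [OF R(1) dvd_mult2 [OF R(1)]])
      finally obtain a where "h - g * (u * s) = f * a" by (rule dvdE)
      then have "h = f * a + g * (u * s)" by (simp add: algebra_simps)
      then show ?thesis by blast
    qed
    then show "\<exists>N. \<forall>g h. v g + enat N \<le> v h \<longrightarrow> (\<exists>a b. h = f * a + g * b)" by blast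
  qed
  then show thesis using that v_X by blast
qed

section \<open>Valuation and semigroup under blowing up\<close>

text \<open>
  One step of the resolution, in the chart \<open>(x, y) = (u, u (v + c))\<close>.
\<close>

locale irreducible_blowup = strict: branch_valuation f' v'
  for f' :: germ and v' :: "germ \<Rightarrow> enat" +
  fixes f :: germ and c :: complex
  assumes irreducible: "irreducible f"
    and strict_transform: "blowup c f = X ^ curve_mult f * f'"
    and origin: "series f' $ 0 $ 0 = 0"
begin

abbreviation "n \<equiv> curve_mult f"

lemmas strict_props = irreducible_strict_transform [OF irreducible strict_transform origin]

lemma n_pos: "n > 0"
  using strict_props(1) origin by (cases n) (auto simp: regular_order_def)

lemma strict_low_degree_representative:
  obtains q r where "g = q * f' + r" "y_degree_below n r" "v' g = v' r"
proof -
  obtain q r where qr: "g = q * f' + r" "y_degree_below n r"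
    using weierstrass_division [OF strict_props(1)] by blast
  have "v' (q * f') = \<infinity>" by (simp add: strict.v_eq_infinity_iff)
  then have "v' r = v' g"
    using strict.v_add [of "q * f'" r] strict.v_diff [of g "q * f'"] qr(1) by simp
  then show thesis using that qr by simp
qed

text \<open>
  The exceptional line meets \<open>f'\<close> with multiplicity \<open>n\<close>: a basis modulo \<open>(f', u)\<close> is
  \<open>1, v, \<dots>, v^(n-1)\<close>, because \<open>f'\<close> is \<open>v^n\<close> times a unit on \<open>u = 0\<close>.
\<close>

lemma v_X: "v' X = enat n"
proof -
  let ?I = "{f' * a + X * b | a b. True}"
  have Y: "series (Y ^ j) $ i $ k = (if i = 0 \<and> j = k then 1 else 0)" for i j k
    by (simp add: series_simps fps_const_power)
  have inj: "inj_on (\<lambda>j. Y ^ j) {..<n}"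
    by (rule inj_onI) (metis Y zero_neq_one)
  have "quotient_basis ?I ((\<lambda>j. Y ^ j) ` {..<n})"
    unfolding quotient_basis_iff
  proof (intro conjI)
    show "spans_mod ?I UNIV ((\<lambda>j. Y ^ j) ` {..<n})"
      unfolding spans_mod_def
    proof
      fix h
      obtain q r where qr: "h = q * f' + r" "y_degree_below n r"
        using weierstrass_division [OF strict_props(1)] by blast
      define a where "a = (\<lambda>b. series r $ 0 $ (inv_into {..<n} (\<lambda>j. Y ^ j) b))"
      let ?s = "\<Sum>b\<in>(\<lambda>j. Y ^ j) ` {..<n}. const_germ (a b) * b"
      have s: "?s = (\<Sum>j<n. const_germ (series r $ 0 $ j) * Y ^ j)"
        unfolding sum.reindex [OF inj] o_def
        by (intro sum.cong) (auto simp: a_def inv_into_f_f [OF inj])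
      have "series ?s $ 0 $ k = series r $ 0 $ k" for k
      proof -
        have "series ?s $ 0 $ k = (\<Sum>j<n. if j = k then series r $ 0 $ k else 0)"
          unfolding s series_sum fps_sum_nth nth_const_mult Y by (intro sum.cong) auto
        then show ?thesis using qr(2) by (simp add: y_degree_below_def)
      qed
      then have "X ^ 1 dvd r - ?s"
        unfolding X_power_dvd_iff by (auto simp: minus_germ.rep_eq fps_eq_iff)
      then obtain t where "r - ?s = X * t" by (auto elim: dvdE)
      then have "h - ?s = f' * q + X * t" using qr(1) by (simp add: algebra_simps)
      then show "\<exists>a. h - (\<Sum>b\<in>(\<lambda>j. Y ^ j) ` {..<n}. const_germ (a b) * b) \<in> ?I" by blast
    qed
    show "indep_mod ?I ((\<lambda>j. Y ^ j) ` {..<n})"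
      unfolding indep_mod_def
    proof (intro allI impI ballI)
      fix a b
      assume "(\<Sum>b\<in>(\<lambda>j. Y ^ j) ` {..<n}. const_germ (a b) * b) \<in> ?I"
      then obtain g h where gh: "(\<Sum>b\<in>(\<lambda>j. Y ^ j) ` {..<n}. const_germ (a b) * b) = f' * g + X * h"
        by blast
      assume "b \<in> (\<lambda>j. Y ^ j) ` {..<n}"
      then obtain k where k: "b = Y ^ k" "k < n" by blast
      have "series (\<Sum>b\<in>(\<lambda>j. Y ^ j) ` {..<n}. const_germ (a b) * b) $ 0 $ k
          = (\<Sum>j<n. if j = k then a b else 0)"
        unfolding sum.reindex [OF inj] o_def series_sum fps_sum_nth nth_const_mult Y
        by (intro sum.cong) (auto simp: k)
      moreover have "series (f' * g + X * h) $ 0 $ k = 0"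
      proof -
        have "series f' $ 0 $ i = 0" if "i \<le> k" for i
          using strict_props(1) that k(2) by (simp add: regular_order_def)
        then show ?thesis by (simp add: plus_germ.rep_eq nth_0_mult X.rep_eq fps_mult_nth)
      qed
      ultimately show "a b = 0" using k(2) gh by simp
    qed
  qed simp
  then have mult: "intersection_mult f' X = n"
    using intersection_mult_eqI [of f' X] by (simp add: card_image [OF inj])
  have "\<not> f' dvd X"
  proof
    assume "f' dvd X"
    then obtain q where q: "X = f' * q" by (rule dvdE)
    then have "series f' $ 0 * series q $ 0 = 0" by (simp add: X.rep_eq flip: nth_0_mult)
    moreover have "series f' $ 0 \<noteq> 0"
      using strict_props(1) by (auto simp: regular_order_iff_subdegree)
    ultimately have "X ^ 1 dvd q" unfolding X_power_dvd_iff by simp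
    then obtain t where "q = X * t" by (auto elim: dvdE)
    then have "X * 1 = X * (f' * t)" using q by (simp add: mult_ac)
    then have "f' dvd 1" using X_nonzero by (metis dvd_triv_left mult_cancel_left)
    then show False using origin by (simp add: germ_unit_iff)
  qed
  then obtain m where "v' X = enat m" using strict.v_eq_infinity_iff by (cases "v' X") auto
  then show ?thesis using strict.intersection_mult_eq mult by simp
qed

lemma v_X_power_mult: "v' (X ^ a * g) = enat (n * a) + v' g"
proof (induction a)
  case 0
  then show ?case by (simp add: zero_enat_def [symmetric])
next
  case (Suc a)
  have "v' (X ^ Suc a * g) = v' X + v' (X ^ a * g)"
    by (simp add: strict.v_mult mult.assoc flip: add.assoc)
  then show ?case unfolding Suc v_X by (simp add: add.assoc [symmetric])
qed

text \<open>
  The algebraic properties pass through the pull-back, as \<open>f'\<close> divides the pull-back of \<open>g\<close> only if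
  \<open>f\<close> divides \<open>g\<close>. Large values and multiples come from upstairs after multiplication by \<open>u^(n-1)\<close>,
  which has value \<open>n (n - 1)\<close>: modulo \<open>f'\<close> every germ has degree below \<open>n\<close> in \<open>v\<close>, and its product
  with \<open>u^(n-1)\<close> is a pull-back.
\<close>

sublocale branch_valuation f "\<lambda>g. v' (blowup c g)"
proof
  obtain N where N: "\<And>s. s \<ge> N \<Longrightarrow> \<exists>g. v' g = enat s" using strict.v_all_large by blast
  obtain M where M: "\<And>g h. v' g + enat M \<le> v' h \<Longrightarrow> \<exists>a b. h = f' * a + g * b"
    using strict.v_conductor by blast
  define m where "m = n * (n - 1)"
  have image: "\<exists>p q. blowup c p = X ^ (n - 1) * (g - q * f')" for g
  proof -
    obtain q r where qr: "g = q * f' + r" "y_degree_below n r"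
      using strict_low_degree_representative by blast
    then obtain p where "blowup c p = X ^ (n - 1) * r"
      using blowup_surj_low_degree [of "n - 1" r c] n_pos by auto
    then show ?thesis using qr by (intro exI [of _ p] exI [of _ q]) simp
  qed
  show "v' (blowup c g) = \<infinity> \<longleftrightarrow> f dvd g" for g
    by (simp add: strict.v_eq_infinity_iff strict_props(2))
  show "\<exists>a. v' (blowup c g) < v' (blowup c (g - const_germ a * h))"
    if "v' (blowup c g) = v' (blowup c h)" "v' (blowup c h) \<noteq> \<infinity>" for g h
    using strict.v_leaf [OF that] by (simp add: blowup_diff blowup_mult blowup_const)
  show "\<exists>N. \<forall>s\<ge>N. \<exists>g. v' (blowup c g) = enat s"
  proof (rule exI, intro allI impI)
    fix s assume s: "s \<ge> m + N"
    then obtain g where g: "v' g = enat (s - m)" using N [of "s - m"] by force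
    obtain q r where qr: "g = q * f' + r" "y_degree_below n r" "v' g = v' r"
      using strict_low_degree_representative by blast
    then obtain p where "blowup c p = X ^ (n - 1) * r"
      using blowup_surj_low_degree [of "n - 1" r c] n_pos by auto
    then have "v' (blowup c p) = enat s"
      using s g qr(3) by (simp add: v_X_power_mult m_def)
    then show "\<exists>g. v' (blowup c g) = enat s" by blast
  qed
  show "\<exists>N. \<forall>g h. v' (blowup c g) + enat N \<le> v' (blowup c h) \<longrightarrow> (\<exists>a b. h = f * a + g * b)"
  proof (rule exI, intro allI impI)
    fix g h assume "v' (blowup c g) + enat (m + M) \<le> v' (blowup c h)"
    then have "v' (X ^ (n - 1) * blowup c g) + enat M \<le> v' (blowup c h)"
      unfolding v_X_power_mult m_def [symmetric] by (simp add: add_ac flip: plus_enat_simps(1))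
    then obtain a b where ab: "blowup c h = f' * a + X ^ (n - 1) * blowup c g * b"
      using M by blast
    obtain p q where p: "blowup c p = X ^ (n - 1) * (b - q * f')" using image by blast
    have "blowup c (h - g * p) = f' * (a + X ^ (n - 1) * blowup c g * q)"
      by (simp add: blowup_diff blowup_mult ab p algebra_simps)
    then have "f dvd h - g * p" using strict_props(2) by (metis dvd_triv_left)
    then obtain d where "h - g * p = f * d" by (rule dvdE)
    then have "h = f * d + g * p" by (simp add: algebra_simps)
    then show "\<exists>a b. h = f * a + g * b" by blast
  qed
qed (simp_all add: blowup_mult blowup_add strict.v_mult strict.v_add)

lemma v_values_order_ge:
  "v_values {g. order_ge a g} \<subseteq> (+) (n * a) ` strict.v_values UNIV"
proof
  fix s assume "s \<in> v_values {g. order_ge a g}"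
  then obtain g where g: "order_ge a g" "v' (blowup c g) = enat s" by (auto simp: v_values_def)
  then obtain h where "blowup c g = X ^ a * h"
    using X_power_dvd_blowup_iff by (metis dvdE)
  then have "enat s = enat (n * a) + v' h" using g(2) v_X_power_mult by metis
  then obtain t where "v' h = enat t" "s = n * a + t" by (cases "v' h") auto
  then show "s \<in> (+) (n * a) ` strict.v_values UNIV" by (auto simp: strict.v_values_def)
qed

lemma order_ge_dimension:
  obtains B where "finite B" "B \<subseteq> {g. order_ge a g}"
    "spans_mod {g. order_ge a g \<and> enat k \<le> v' (blowup c g)} {g. order_ge a g} B"
    "indep_mod {g. order_ge a g \<and> enat k \<le> v' (blowup c g)} B"
    "card B = card {s \<in> v_values {g. order_ge a g}. s < k}"
proof -
  let ?I = "{g. order_ge a g \<and> enat k \<le> v' (blowup c g)}"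
  have "germ_space.subspace ({g. order_ge a g} \<inter> {g. enat k \<le> v' (blowup c g)})"
    by (rule germ_space.subspace_inter [OF subspace_order_ge subspace_v_ge])
  also have "{g. order_ge a g} \<inter> {g. enat k \<le> v' (blowup c g)} = ?I" by blast
  finally have sub: "germ_space.subspace ?I" .
  have "s \<in> v_values ?I \<longleftrightarrow> s \<in> v_values {g. order_ge a g} \<and> k \<le> s" for s
    unfolding v_values_def by simp (metis enat_ord_simps(1))
  then have vals: "v_values {g. order_ge a g} - v_values ?I
      = {s \<in> v_values {g. order_ge a g}. s < k}"
    unfolding set_eq_iff Diff_iff mem_Collect_eq not_le [symmetric] by blast
  show thesis
  proof (rule quotient_dimension_eq_card_values [OF subspace_order_ge sub])
    show "?I \<subseteq> {g. order_ge a g}" by blast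
    show "w \<in> ?I" if "w \<in> {g. order_ge a g}" "enat k \<le> v' (blowup c w)" for w
      using that by blast
  qed (rule that, assumption+, simp only: vals)
qed

lemma v_ge_dimension:
  obtains B where "finite B"
    "spans_mod {g. enat k \<le> v' (blowup c g)} UNIV B"
    "indep_mod {g. enat k \<le> v' (blowup c g)} B"
    "card B = card {s \<in> v_values UNIV. s < k}"
proof -
  let ?I = "{g. enat k \<le> v' (blowup c g)}"
  have "v_values UNIV - v_values ?I = {s \<in> v_values UNIV. s < k}"
    unfolding v_values_v_ge by auto
  then show thesis
    using quotient_dimension_eq_card_values
      [OF germ_space.subspace_UNIV subspace_v_ge [of "enat k"] subset_UNIV, of k] that
    by force
qed

text \<open>
  A basis of the germs modulo order \<open>a\<close> together with one of the germs of order at least \<open>a\<close> modulo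
  value \<open>k\<close> spans all germs modulo value \<open>k\<close>.
\<close>

lemma card_semigroup_le:
  "2 * card {s \<in> v_values UNIV. s < k}
     \<le> a * (a + 1) + 2 * card {s \<in> strict.v_values UNIV. s < k - n * a}"
proof -
  let ?J = "{g. order_ge a g}" and ?I = "{g. enat k \<le> v' (blowup c g)}"
  let ?JI = "{g. order_ge a g \<and> enat k \<le> v' (blowup c g)}"
  obtain M where M: "quotient_basis ?J M" "2 * card M = a * (a + 1)"
    by (rule order_ge_quotient_basis)
  obtain B where B: "finite B" "B \<subseteq> ?J" "spans_mod ?JI ?J B"
    "card B = card {s \<in> v_values ?J. s < k}"
    by (rule order_ge_dimension)
  obtain S where S: "finite S" "indep_mod ?I S" "card S = card {s \<in> v_values UNIV. s < k}"
    by (rule v_ge_dimension)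
  have "M \<inter> B = {}"
    using indep_mod_disjoint [OF subspace_order_ge] M(1) B(2) by (auto simp: quotient_basis_iff)
  then have "spans_mod ?JI UNIV (M \<union> B)"
    using M(1) B spans_mod_chain by (auto simp: quotient_basis_iff)
  then have "spans_mod ?I UNIV (M \<union> B)" unfolding spans_mod_def by blast
  then have "card S \<le> card (M \<union> B)"
    using S M(1) B(1) by (intro indep_mod_card_le [OF subspace_v_ge]) (auto simp: quotient_basis_iff)
  also have "\<dots> \<le> card M + card B" by (rule card_Un_le)
  finally have "card S \<le> card M + card B" .
  moreover have "card B \<le> card {s \<in> strict.v_values UNIV. s < k - n * a}"
  proof -
    have "{s \<in> v_values ?J. s < k} \<subseteq> (+) (n * a) ` {s \<in> strict.v_values UNIV. s < k - n * a}"
      using v_values_order_ge [of a] by auto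
    then have "card B \<le> card ((+) (n * a) ` {s \<in> strict.v_values UNIV. s < k - n * a})"
      unfolding B(4) by (intro card_mono) auto
    then show ?thesis by (simp add: card_image)
  qed
  ultimately show ?thesis using M(2) S(3) by linarith
qed

text \<open>
  The witness \<open>a\<close> is the least order of a germ of value at least \<open>k\<close>. With this choice the germs of
  value at least \<open>k\<close> all have order at least \<open>a\<close>, so that the two bases together are independent
  modulo value \<open>k\<close>. Dividing by \<open>h'\<close> shows that the second basis is as large as possible.
\<close>

lemma card_semigroup_ge:
  obtains a where "a * (a + 1) + 2 * card {s \<in> strict.v_values UNIV. s < k - n * a}
     \<le> 2 * card {s \<in> v_values UNIV. s < k}"
proof -
  let ?I = "{g. enat k \<le> v' (blowup c g)}"
  have "f \<noteq> 0" using irreducible by (auto simp: irreducible_def)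
  moreover have "f \<in> ?I" using v_eq_infinity_iff [of f] by simp
  ultimately obtain h where h: "h \<in> ?I" "h \<noteq> 0"
    and least: "\<And>g. g \<in> ?I \<Longrightarrow> g \<noteq> 0 \<Longrightarrow> curve_mult h \<le> curve_mult g"
    using ex_has_least_nat [of "\<lambda>g. g \<in> ?I \<and> g \<noteq> 0" f curve_mult] by blast
  define a where "a = curve_mult h"
  let ?J = "{g. order_ge a g}"
  let ?JI = "{g. order_ge a g \<and> enat k \<le> v' (blowup c g)}"
  have "order_ge a g" if "g \<in> ?I" for g
    using least [OF that] order_ge_iff_curve_mult [of g a]
    by (cases "g = 0") (auto simp: a_def order_ge_def zero_germ.rep_eq)
  then have JI: "?JI = ?I" by blast
  obtain M where M: "quotient_basis ?J M" "2 * card M = a * (a + 1)"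
    by (rule order_ge_quotient_basis)
  obtain B where B: "finite B" "B \<subseteq> ?J" "indep_mod ?JI B"
    "card B = card {s \<in> v_values ?J. s < k}"
    by (rule order_ge_dimension)
  obtain S where S: "finite S" "spans_mod ?I UNIV S" "card S = card {s \<in> v_values UNIV. s < k}"
    by (rule v_ge_dimension)
  have M': "finite M" "indep_mod ?J M" using M(1) by (auto simp: quotient_basis_iff)
  have "indep_mod ?JI (M \<union> B)"
    using indep_mod_chain [OF subspace_order_ge _ B(2) M'(2) B(3) M'(1) B(1)] by blast
  then have "card (M \<union> B) \<le> card S"
    unfolding JI using S M'(1) B(1)
    by (intro indep_mod_card_le [OF subspace_v_ge]) auto
  moreover have "M \<inter> B = {}"
    using indep_mod_disjoint [OF subspace_order_ge M'(2,1) B(2)] .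
  ultimately have "card M + card B \<le> card S"
    using M' B(1) by (simp add: card_Un_disjoint)
  moreover have "card {s \<in> strict.v_values UNIV. s < k - n * a} \<le> card B"
  proof -
    obtain h' where h': "blowup c h = X ^ a * h'"
      using X_power_dvd_blowup_iff [of a c h] order_ge_iff_curve_mult [OF h(2)]
      by (auto simp: a_def elim: dvdE)
    obtain e where e: "regular_order e h'" "e \<le> a"
      using strict_transform_regular [OF h(2)] h' by (auto simp: a_def)
    have vh': "enat (k - n * a) \<le> v' h'"
      using h(1) unfolding mem_Collect_eq h' v_X_power_mult by (cases "v' h'") auto
    \<comment> \<open>A germ \<open>q\<close> upstairs of value \<open>s < k - n a\<close> may be replaced by its remainder modulo \<open>h'\<close>,
      and \<open>u^a\<close> times the remainder is a pull-back.\<close>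
    have "(+) (n * a) ` {s \<in> strict.v_values UNIV. s < k - n * a} \<subseteq> {s \<in> v_values ?J. s < k}"
    proof (rule image_subsetI)
      fix s assume "s \<in> {s \<in> strict.v_values UNIV. s < k - n * a}"
      then obtain q where q: "v' q = enat s" "s < k - n * a" by (auto simp: strict.v_values_def)
      obtain Q r where Q: "q = Q * h' + r" "y_degree_below e r"
        using weierstrass_division [OF e(1)] by blast
      have "v' q < v' (- (Q * h'))"
      proof -
        have "v' q < enat (k - n * a)" using q by simp
        also have "\<dots> \<le> v' h'" by (rule vh')
        also have "\<dots> \<le> v' Q + v' h'" by (simp add: add_increasing)
        finally show ?thesis by (simp add: strict.v_minus strict.v_mult)
      qed
      then have "v' (q + - (Q * h')) = v' q" by (rule strict.v_add_eq)
      then have r: "v' r = enat s" using q Q by simp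
      have "y_degree_below (Suc a) r" using Q(2) e(2) by (auto simp: y_degree_below_def)
      then obtain p where p: "blowup c p = X ^ a * r" by (rule blowup_surj_low_degree)
      then have "order_ge a p" using X_power_dvd_blowup_iff [of a c p] by simp
      moreover have "v' (blowup c p) = enat (n * a + s)" by (simp add: p v_X_power_mult r)
      ultimately show "n * a + s \<in> {s \<in> v_values ?J. s < k}"
        using q(2) by (auto simp: v_values_def)
    qed
    then have "card ((+) (n * a) ` {s \<in> strict.v_values UNIV. s < k - n * a}) \<le> card B"
      unfolding B(4) by (intro card_mono) auto
    then show ?thesis by (simp add: card_image)
  qed
  ultimately show thesis using that [of a] M(2) S(3) by linarith
qed

end

section \<open>Counting functions in terms of multiplicities\<close>

text \<open>
  Requiring multiplicity \<open>a\<close> at a point costs \<open>a (a + 1) / 2\<close> linear conditions and contributes \<open>n a\<close>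
  to the intersection multiplicity with a branch of multiplicity \<open>n\<close> at this point.
\<close>

definition point_costs :: "nat \<Rightarrow> (int \<times> int) set" where
  "point_costs n = {(int (a * (a + 1) div 2), int (n * a)) | a. True}"

text \<open>
  The sum is the Minkowski sum of sets of pairs. The order of the multiplicities is irrelevant because
  Minkowski addition is commutative.
\<close>

definition cluster_costs :: "nat list \<Rightarrow> (int \<times> int) set" where
  "cluster_costs ms = sum_list (map point_costs ms)"

text \<open>
  \<open>F k = min {p + max 0 (k - q) | (p, q) \<in> cluster_costs ms}\<close>. The last summand accounts for the
  infinitely near points of multiplicity \<open>1\<close>, each of which raises the intersection multiplicity by
  \<open>1\<close> at the cost of one condition.
\<close>

definition cost_envelope :: "nat list \<Rightarrow> (int \<Rightarrow> int) \<Rightarrow> bool" where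
  "cost_envelope ms F \<longleftrightarrow> (\<forall>k.
     (\<forall>p q. (p, q) \<in> cluster_costs ms \<longrightarrow> F k \<le> p + max 0 (k - q)) \<and>
     (\<exists>p q. (p, q) \<in> cluster_costs ms \<and> F k = p + max 0 (k - q)))"

lemma cluster_costs_cong_mset: "mset xs = mset ys \<Longrightarrow> cluster_costs xs = cluster_costs ys"
  unfolding cluster_costs_def by (metis mset_map sum_mset_sum_list)

lemma cluster_costs_Nil: "(p, q) \<in> cluster_costs [] \<longleftrightarrow> p = 0 \<and> q = 0"
  by (simp add: cluster_costs_def set_zero zero_prod_def)

lemma cluster_costs_append: "cluster_costs (xs @ ys) = cluster_costs xs + cluster_costs ys"
  by (simp add: cluster_costs_def)

lemma cluster_costs_Cons:
  "(p, q) \<in> cluster_costs (n # ms) \<longleftrightarrow> (\<exists>a p' q'. (p', q') \<in> cluster_costs ms \<and>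
     p = int (a * (a + 1) div 2) + p' \<and> q = int (n * a) + q')"
  by (force simp: cluster_costs_def point_costs_def set_plus_def)

lemma cost_envelope_unique:
  assumes "cost_envelope ms F" "cost_envelope ms G"
  shows "F = G"
proof
  fix k
  have "F k \<le> G k" "G k \<le> F k" using assms unfolding cost_envelope_def by metis+
  then show "F k = G k" by simp
qed

lemma cost_envelope_Cons:
  assumes F': "cost_envelope ms F'"
    and upper: "\<And>k a. F k \<le> int (a * (a + 1) div 2) + F' (k - int (n * a))"
    and lower: "\<And>k. \<exists>a. int (a * (a + 1) div 2) + F' (k - int (n * a)) \<le> F k"
  shows "cost_envelope (n # ms) F"
  unfolding cost_envelope_def cluster_costs_Cons
proof (intro allI conjI impI)
  have le: "F k \<le> int (a * (a + 1) div 2) + p + max 0 (k - (int (n * a) + q))"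
    if "(p, q) \<in> cluster_costs ms" for k a p q
  proof -
    have "F' (k - int (n * a)) \<le> p + max 0 (k - int (n * a) - q)"
      using F' that unfolding cost_envelope_def by blast
    then show ?thesis using upper [of k a] by (simp add: algebra_simps)
  qed
  fix k
  show "F k \<le> p + max 0 (k - q)"
    if "\<exists>a p' q'. (p', q') \<in> cluster_costs ms \<and>
      p = int (a * (a + 1) div 2) + p' \<and> q = int (n * a) + q'" for p q
    using that le by blast
  obtain a where a: "int (a * (a + 1) div 2) + F' (k - int (n * a)) \<le> F k"
    using lower by blast
  obtain p q where pq: "(p, q) \<in> cluster_costs ms" "F' (k - int (n * a)) = p + max 0 (k - int (n * a) - q)"
    using F' unfolding cost_envelope_def by blast
  have "F k = int (a * (a + 1) div 2) + p + max 0 (k - (int (n * a) + q))"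
    using le [OF pq(1), of k a] a pq(2) by (simp add: algebra_simps)
  then show "\<exists>p q. (\<exists>a p' q'. (p', q') \<in> cluster_costs ms \<and>
      p = int (a * (a + 1) div 2) + p' \<and> q = int (n * a) + q') \<and> F k = p + max 0 (k - q)"
    using pq(1) by blast
qed

lemma cluster_costs_nonneg: "(p, q) \<in> cluster_costs ms \<Longrightarrow> p \<ge> 0"
  by (induction ms arbitrary: p q)
    (auto simp: cluster_costs_Nil cluster_costs_Cons)

lemma cost_envelope_nonneg: "cost_envelope ms F \<Longrightarrow> F k \<ge> 0"
  unfolding cost_envelope_def by (metis cluster_costs_nonneg add_nonneg_nonneg max.cobounded1)

text \<open>
  Splitting \<open>k\<close> as \<open>q1 + (k - q1)\<close> gives the upper bound, and subadditivity of \<open>max 0\<close> shows that no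
  other splitting is better.
\<close>

lemma cost_envelope_append:
  assumes F: "cost_envelope xs F" and G: "cost_envelope ys G"
  shows "cost_envelope (xs @ ys) (F \<diamondop> G)"
  unfolding cost_envelope_def
proof (intro allI conjI impI)
  fix k
  let ?A = "{F j1 + G j2 | j1 j2. j1 + j2 = k}"
  have nonneg: "F j1 + G j2 \<ge> 0" for j1 j2
    using cost_envelope_nonneg F G by (simp add: add_nonneg_nonneg)
  \<comment> \<open>The infimum is attained because the values are nonnegative integers.\<close>
  obtain j where j: "\<And>i. nat (F j + G (k - j)) \<le> nat (F i + G (k - i))"
    using ex_has_least_nat [of "\<lambda>_. True" 0 "\<lambda>j. nat (F j + G (k - j))"] by auto
  have min: "F j + G (k - j) \<le> F i + G (k - i)" for i
    using j [of i] nonneg [of i "k - i"] by (simp add: nat_le_eq_zle)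
  have conv: "(F \<diamondop> G) k = F j + G (k - j)"
    unfolding min_conv_def
  proof (rule cInf_eq_minimum)
    show "F j + G (k - j) \<in> ?A" by (intro CollectI exI [of _ j] exI [of _ "k - j"]) simp
    show "F j + G (k - j) \<le> x" if "x \<in> ?A" for x
    proof -
      obtain j1 j2 where "x = F j1 + G j2" "j1 + j2 = k" using \<open>x \<in> ?A\<close> by blast
      then show ?thesis using min [of j1] by auto
    qed
  qed
  have le: "(F \<diamondop> G) k \<le> (p1 + p2) + max 0 (k - (q1 + q2))"
    if "(p1, q1) \<in> cluster_costs xs" "(p2, q2) \<in> cluster_costs ys" for p1 q1 p2 q2
  proof -
    have "F q1 \<le> p1 + max 0 (q1 - q1)" "G (k - q1) \<le> p2 + max 0 (k - q1 - q2)"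
      using F G that unfolding cost_envelope_def by blast+
    then show ?thesis using min [of q1] conv by (simp add: algebra_simps)
  qed
  show "(F \<diamondop> G) k \<le> p + max 0 (k - q)" if "(p, q) \<in> cluster_costs (xs @ ys)" for p q
    using that le by (auto simp: cluster_costs_append set_plus_def)
  obtain p1 q1 where 1: "(p1, q1) \<in> cluster_costs xs" "F j = p1 + max 0 (j - q1)"
    using F unfolding cost_envelope_def by blast
  obtain p2 q2 where 2: "(p2, q2) \<in> cluster_costs ys" "G (k - j) = p2 + max 0 (k - j - q2)"
    using G unfolding cost_envelope_def by blast
  have "(F \<diamondop> G) k = (p1 + p2) + max 0 (k - (q1 + q2))"
    using le [OF 1(1) 2(1)] 1(2) 2(2) conv by linarith
  moreover have "(p1 + p2, q1 + q2) \<in> cluster_costs (xs @ ys)"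
    unfolding cluster_costs_append using set_plus_intro [OF 1(1) 2(1)] by simp
  ultimately show "\<exists>p q. (p, q) \<in> cluster_costs (xs @ ys) \<and> (F \<diamondop> G) k = p + max 0 (k - q)"
    by blast
qed

lemma twice_triangle: "2 * int (a * (a + 1) div 2) = int a * (int a + 1)"
proof -
  have "2 * (a * (a + 1) div 2) = a * (a + 1)" by simp
  then show ?thesis by (metis of_nat_1 of_nat_add of_nat_mult of_nat_numeral)
qed

lemma twice_triangle_pred: "2 * int (n * (n - 1) div 2) = int n * (int n - 1)"
  using twice_triangle [of "n - 1"] by (cases n) (simp_all add: mult.commute)

definition multiplicity_delta :: "nat list \<Rightarrow> int" where
  "multiplicity_delta ms = (\<Sum>n\<leftarrow>ms. int (n * (n - 1) div 2))"

text \<open>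
  For one multiplicity, \<open>a (a + 1) + n (n - 1) - 2 n a = (a - n) (a - n + 1) \<ge> 0\<close>.
\<close>

lemma cluster_costs_gap:
  assumes "(p, q) \<in> cluster_costs ms"
  shows "q - p \<le> multiplicity_delta ms"
  using assms
proof (induction ms arbitrary: p q)
  case (Cons n ms)
  then obtain a p' q' where a: "(p', q') \<in> cluster_costs ms"
      "p = int (a * (a + 1) div 2) + p'" "q = int (n * a) + q'"
    by (auto simp: cluster_costs_Cons)
  have "int (n * a) - int (a * (a + 1) div 2) \<le> int (n * (n - 1) div 2)"
  proof -
    define b where "b = int a - int n"
    have "0 \<le> b * (b + 1)"
    proof (cases "b \<ge> 0")
      case False
      then show ?thesis by (intro mult_nonpos_nonpos) auto
    qed simp
    then have "2 * (int n * int a) \<le> int a * (int a + 1) + int n * (int n - 1)"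
      by (simp add: b_def algebra_simps)
    then have "2 * int (n * a) \<le> 2 * int (a * (a + 1) div 2) + 2 * int (n * (n - 1) div 2)"
      unfolding twice_triangle twice_triangle_pred by simp
    then show ?thesis by linarith
  qed
  then show ?case using Cons.IH [OF a(1)] a by (simp add: multiplicity_delta_def)
qed (simp add: cluster_costs_Nil multiplicity_delta_def)

text \<open>
  Equality holds for \<open>a = n\<close>, the choice of the multiplicities of the branch itself.
\<close>

lemma cluster_costs_gap_attained:
  "\<exists>p q. (p, q) \<in> cluster_costs ms \<and> q - p = multiplicity_delta ms"
proof (induction ms)
  case Nil
  show ?case by (simp add: cluster_costs_Nil multiplicity_delta_def)
next
  case (Cons n ms)
  then obtain p q where pq: "(p, q) \<in> cluster_costs ms" "q - p = multiplicity_delta ms" by blast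
  have "int (n * n) - int (n * (n + 1) div 2) = int (n * (n - 1) div 2)"
    using twice_triangle [of n] twice_triangle_pred [of n] by (simp add: algebra_simps)
  then show ?case using pq
    by (intro exI [of _ "int (n * (n + 1) div 2) + p"] exI [of _ "int (n * n) + q"])
       (auto simp: cluster_costs_Cons multiplicity_delta_def)
qed

text \<open>
  For large \<open>k\<close> the minimum is \<open>k\<close> minus the largest possible value of \<open>q - p\<close>.
\<close>

lemma cost_envelope_eventually_linear:
  assumes F: "cost_envelope ms F" and lin: "\<And>k. k \<ge> N \<Longrightarrow> F k = k - \<delta>"
  shows "\<delta> = multiplicity_delta ms"
proof -
  obtain p q where pq: "(p, q) \<in> cluster_costs ms" "q - p = multiplicity_delta ms"
    using cluster_costs_gap_attained by blast
  define k where "k = max N q"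
  have k: "N \<le> k" "q \<le> k" by (auto simp: k_def)
  have "F k \<le> p + max 0 (k - q)" using F pq(1) unfolding cost_envelope_def by blast
  then have 1: "k - \<delta> \<le> k - multiplicity_delta ms" using lin [OF k(1)] k(2) pq(2) by simp
  obtain p' q' where pq': "(p', q') \<in> cluster_costs ms" "F k = p' + max 0 (k - q')"
    using F unfolding cost_envelope_def by blast
  then have "F k \<ge> k - multiplicity_delta ms" using cluster_costs_gap by fastforce
  then show ?thesis using 1 lin [OF k(1)] by simp
qed

lemma counting_function_eq_card_nat:
  "counting_function f k = int (card {s \<in> curve_semigroup f. s < nat k})"
proof -
  have "{s \<in> curve_semigroup f. int s < k} = {s \<in> curve_semigroup f. s < nat k}" by auto
  then show ?thesis by (simp add: counting_function_def)
qed

lemma (in irreducible_blowup) cost_envelope_blowup: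
  assumes "cost_envelope ms (counting_function f')"
  shows "cost_envelope (n # ms) (counting_function f)"
proof (rule cost_envelope_Cons [OF assms])
  have nat: "nat (k - int m) = nat k - m" for k m by linarith
  have tri: "2 * int (a * (a + 1) div 2) = int (a * (a + 1))" for a :: nat
    by (simp only: twice_triangle) (simp add: distrib_left)
  show "counting_function f k \<le> int (a * (a + 1) div 2) + counting_function f' (k - int (n * a))" for k a
    using card_semigroup_le [of "nat k" a] tri [of a]
    unfolding counting_function_eq_card_nat curve_semigroup_eq strict.curve_semigroup_eq nat by linarith
  show "\<exists>a. int (a * (a + 1) div 2) + counting_function f' (k - int (n * a)) \<le> counting_function f k" for k
  proof -
    obtain a where a: "a * (a + 1) + 2 * card {s \<in> strict.v_values UNIV. s < nat k - n * a}
       \<le> 2 * card {s \<in> v_values UNIV. s < nat k}"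
      by (rule card_semigroup_ge)
    show ?thesis using a tri [of a]
      unfolding counting_function_eq_card_nat curve_semigroup_eq strict.curve_semigroup_eq nat
      by (intro exI [of _ a]) linarith
  qed
qed

lemma (in branch_valuation) counting_function_eventually_linear:
  "\<exists>N. \<forall>k\<ge>N. counting_function f k = k - int (delta_invariant f)"
proof -
  obtain N where N: "\<And>s. s \<ge> N \<Longrightarrow> s \<in> curve_semigroup f"
    using v_all_large unfolding curve_semigroup_eq v_values_def by auto
  have "counting_function f k = k - int (delta_invariant f)" if "k \<ge> int N" for k
  proof -
    let ?A = "{s \<in> curve_semigroup f. s < nat k}"
    have "- curve_semigroup f \<subseteq> {..<nat k}"
    proof
      fix s assume "s \<in> - curve_semigroup f"
      then have "s < N" using N by (meson ComplD linorder_not_less)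
      then show "s \<in> {..<nat k}" using that by simp
    qed
    then have "finite (- curve_semigroup f)" "?A \<union> - curve_semigroup f = {..<nat k}"
      by (auto intro: finite_subset)
    moreover from this have "card (?A \<union> - curve_semigroup f) = card ?A + card (- curve_semigroup f)"
      by (intro card_Un_disjoint) auto
    ultimately show ?thesis
      using that by (simp add: counting_function_eq_card_nat delta_invariant_def)
  qed
  then show ?thesis by blast
qed

text \<open>
  The second chart is the first one after exchanging the coordinates.
\<close>

lemma strict_transform_cases:
  assumes "strict_transform f f'"
  obtains c where "blowup c f = X ^ curve_mult f * f'" "series f' $ 0 $ 0 = 0"
  | c where "blowup c (swap f) = X ^ curve_mult (swap f) * f'" "series f' $ 0 $ 0 = 0"
proof -
  have "blowup c f = X ^ curve_mult f * f'"
    if "total_transform c (series f) = fps_X ^ curve_mult f * series f'" for c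
    using that by (intro germ_eqI) (simp add: blowup.rep_eq series_simps)
  moreover have "blowup 0 (swap f) = X ^ curve_mult (swap f) * f'"
    if "total_transform 0 (swap_series (series f)) = fps_X ^ curve_mult f * series f'"
    using that by (intro germ_eqI) (simp add: blowup.rep_eq series_simps curve_mult_swap)
  ultimately show thesis
    using assms that unfolding strict_transform_def by blast
qed

lemma curve_semigroup_swap:
  assumes "branch_valuation (swap f) v"
  shows "curve_semigroup (swap f) = curve_semigroup f"
proof -
  interpret s: branch_valuation "swap f" v by (rule assms)
  interpret b: branch_valuation f "\<lambda>g. v (swap g)"
    by (rule branch_valuation_swap [OF assms])
  show ?thesis unfolding s.curve_semigroup_eq b.curve_semigroup_eq s.v_values_def b.v_values_def
    by (metis (no_types, opaque_lifting) UNIV_I swap_swap)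
qed

text \<open>
  A germ of order \<open>1\<close> is regular of order \<open>1\<close> in one of the two coordinates.
\<close>

lemma multiplicity_1_valuation:
  assumes f: "irreducible f" "curve_mult f = 1"
  obtains v where "branch_valuation f v" "\<And>s. \<exists>g. v g = enat s"
proof -
  have "f \<noteq> 0" using f(1) by (auto simp: irreducible_def)
  then have "order_ge 1 f" using f(2) by (simp add: order_ge_iff_curve_mult)
  then have 0: "series f $ 0 $ 0 = 0" by (simp add: order_ge_def)
  obtain i j where "i + j = 1" "series f $ i $ j \<noteq> 0"
    using curve_mult_leading [OF \<open>f \<noteq> 0\<close>] f(2) by metis
  then have "i = 0 \<and> j = 1 \<or> i = 1 \<and> j = 0" by auto
  then consider "regular_order 1 f" | "regular_order 1 (swap f)"
    using \<open>series f $ i $ j \<noteq> 0\<close> 0 by (auto simp: regular_order_def swap.rep_eq swap_series_def)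
  then show thesis
  proof cases
    case 1
    then show thesis using branch_valuation_smooth that by blast
  next
    case 2
    then obtain v where v: "branch_valuation (swap f) v" "\<And>s. \<exists>g. v g = enat s"
      using branch_valuation_smooth by blast
    have "\<exists>g. v (swap g) = enat s" for s using v(2) swap_swap by metis
    then show thesis using that [OF branch_valuation_swap [OF v(1)]] by blast
  qed
qed

text \<open>
  Induction along the resolution. The valuation is carried along because each step builds the next
  one from it, and because it identifies the semigroup with a set of values.
\<close>

theorem counting_function_multiplicities:
  assumes "multiplicity_sequence f ms" "irreducible f"
  shows "(\<exists>v. branch_valuation f v) \<and> cost_envelope ms (counting_function f)"
  using assms
proof (induction rule: multiplicity_sequence.induct)
  case (smooth f)
  then obtain v where v: "branch_valuation f v" "\<And>s. \<exists>g. v g = enat s"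
    using multiplicity_1_valuation by blast
  interpret branch_valuation f v by (rule v)
  have "curve_semigroup f = UNIV"
    using v(2) by (auto simp: curve_semigroup_eq v_values_def)
  then have "counting_function f k = max 0 k" for k
    by (simp add: counting_function_eq_card_nat lessThan_def [symmetric])
  then have "cost_envelope [] (counting_function f)"
    by (simp add: cost_envelope_def cluster_costs_Nil)
  then show ?case using v(1) by blast
next
  case (blow_up f f' ms)
  have step: "(\<exists>v. branch_valuation g v) \<and> cost_envelope (curve_mult g # ms) (counting_function g)"
    if g: "irreducible g" "blowup c g = X ^ curve_mult g * f'" "series f' $ 0 $ 0 = 0" for g c
  proof -
    obtain v where v: "branch_valuation f' v" and env: "cost_envelope ms (counting_function f')"
      using blow_up.IH irreducible_strict_transform(3) [OF g] by blast
    interpret irreducible_blowup f' v g c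
      using v g by (intro irreducible_blowup.intro irreducible_blowup_axioms.intro)
    show ?thesis using cost_envelope_blowup [OF env] branch_valuation_axioms by blast
  qed
  from blow_up.hyps(2) show ?case
  proof (cases rule: strict_transform_cases)
    case (1 c)
    then show ?thesis using step blow_up.prems by blast
  next
    case (2 c)
    have "(\<exists>v. branch_valuation (swap f) v) \<and>
        cost_envelope (curve_mult (swap f) # ms) (counting_function (swap f))"
      using step [OF irreducible_swap [OF blow_up.prems] 2] .
    then obtain v where v: "branch_valuation (swap f) v"
      and env: "cost_envelope (curve_mult f # ms) (counting_function (swap f))"
      by (auto simp: curve_mult_swap)
    have "counting_function (swap f) = counting_function f"
      using curve_semigroup_swap [OF v] by (simp add: counting_function_def fun_eq_iff)
    then show ?thesis using env branch_valuation_swap [OF v] by auto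
  qed
qed

section \<open>Collections of singularities\<close>

lemma delta_invariant_multiplicities:
  assumes "multiplicity_sequence f ms" "irreducible f"
  shows "int (delta_invariant f) = multiplicity_delta ms"
proof -
  obtain v where v: "branch_valuation f v" and env: "cost_envelope ms (counting_function f)"
    using counting_function_multiplicities [OF assms] by blast
  interpret branch_valuation f v by (rule v)
  show ?thesis
    using counting_function_eventually_linear cost_envelope_eventually_linear [OF env] by blast
qed

lemma sum_delta_invariant:
  assumes "list_all2 multiplicity_sequence fs ms" "\<forall>f\<in>set fs. irreducible f"
  shows "(\<Sum>f\<leftarrow>fs. int (delta_invariant f)) = multiplicity_delta (concat ms)"
  using assms
  by (induction rule: list_all2_induct)
     (auto simp: multiplicity_delta_def delta_invariant_multiplicities)

lemma multiplicity_delta_cong_mset: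
  "mset xs = mset ys \<Longrightarrow> multiplicity_delta xs = multiplicity_delta ys"
proof -
  have "multiplicity_delta zs = (\<Sum>n\<in>#mset zs. int (n * (n - 1) div 2))" for zs
    by (simp only: multiplicity_delta_def sum_mset_sum_list flip: mset_map)
  then show "mset xs = mset ys \<Longrightarrow> multiplicity_delta xs = multiplicity_delta ys" by simp
qed

lemma cost_envelope_min_conv_list:
  assumes "list_all2 multiplicity_sequence fs ms" "\<forall>f\<in>set fs. irreducible f" "fs \<noteq> []"
  shows "cost_envelope (concat ms) (min_conv_list (map counting_function fs))"
  using assms
proof (induction fs ms rule: list_all2_induct)
  case (Cons f fs m ms)
  have f: "cost_envelope m (counting_function f)"
    using counting_function_multiplicities [OF Cons.hyps(1)] Cons.prems by simp
  show ?case
  proof (cases fs)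
    case Nil
    then show ?thesis using f Cons.hyps by simp
  next
    case (Cons g gs)
    then show ?thesis using cost_envelope_append [OF f] Cons.IH Cons.prems by simp
  qed
qed simp

text \<open>
  The multiplicity sequence of a singular germ is nonempty. So one collection is empty only if the
  other one is, and the case in which \<open>min_conv_list\<close> takes its dummy value is the same for both.
\<close>

lemma concat_multiplicities_eq_Nil_iff:
  assumes "list_all2 multiplicity_sequence fs ms" "\<forall>f\<in>set fs. irreducible_singularity f"
  shows "concat ms = [] \<longleftrightarrow> fs = []"
  using assms
  by (induction rule: list_all2_induct)
     (auto simp: irreducible_singularity_def elim: multiplicity_sequence.cases)

theorem corollary5p1p7:
  fixes d :: int and fs gs :: "germ list" and ms ns :: "nat list list"
  assumes "candidate d fs"
    and "degree_condition d fs"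
    and "\<forall>g\<in>set gs. irreducible_singularity g"
    and "list_all2 multiplicity_sequence fs ms"
    and "list_all2 multiplicity_sequence gs ns"
    and "mset (concat ms) = mset (concat ns)"
  shows "candidate d gs \<and> degree_condition d gs"
proof -
  have fs: "\<forall>f\<in>set fs. irreducible_singularity f" using assms(1) by (simp add: candidate_def)
  then have irr: "\<forall>f\<in>set fs. irreducible f" "\<forall>g\<in>set gs. irreducible g"
    using assms(3) by (auto simp: irreducible_singularity_def)
  have "(\<Sum>f\<leftarrow>fs. int (delta_invariant f)) = (\<Sum>g\<leftarrow>gs. int (delta_invariant g))"
    using sum_delta_invariant [OF assms(4) irr(1)] sum_delta_invariant [OF assms(5) irr(2)]
      multiplicity_delta_cong_mset [OF assms(6)] by simp
  then have "candidate d gs" using assms(1,3) by (simp add: candidate_def)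
  moreover have "min_conv_list (map counting_function fs) = min_conv_list (map counting_function gs)"
  proof (cases "fs = []")
    case True
    then have "concat ms = []" using concat_multiplicities_eq_Nil_iff [OF assms(4) fs] by simp
    then have "concat ns = []" using assms(6) by (metis mset_zero_iff)
    then have "gs = []" using concat_multiplicities_eq_Nil_iff [OF assms(5,3)] by simp
    then show ?thesis using True by simp
  next
    case False
    then have "concat ms \<noteq> []" using concat_multiplicities_eq_Nil_iff [OF assms(4) fs] by simp
    then have "concat ns \<noteq> []" using assms(6) by (metis mset_zero_iff)
    then have "gs \<noteq> []" using concat_multiplicities_eq_Nil_iff [OF assms(5,3)] by blast
    have "cost_envelope (concat ms) (min_conv_list (map counting_function fs))"
      using cost_envelope_min_conv_list [OF assms(4) irr(1) False] .
    moreover have "cost_envelope (concat ms) (min_conv_list (map counting_function gs))"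
      using cost_envelope_min_conv_list [OF assms(5) irr(2) \<open>gs \<noteq> []\<close>]
      unfolding cost_envelope_def cluster_costs_cong_mset [OF assms(6)] .
    ultimately show ?thesis by (rule cost_envelope_unique)
  qed
  then have "degree_condition d gs" using assms(2) by (simp add: degree_condition_def)
  ultimately show ?thesis ..
qed

end
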